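(* Suppose that $\mathscr{T}=(V,E)$ is a countably infinite rooted and leafless directed tree, and $\boldsymbol\lambda=\{\lambda_v\}_{v\in V^\circ}\subseteq(0,\infty)$. Let $\mathscr{P}=(V_{\mathscr{P}},E_{\mathscr{P}})$ be a path in $\mathscr{T}$ and $\boldsymbol\lambda_{\mathscr{P}}=\{\lambda_v\}_{v\in V_{\mathscr{P}}^\circ}$. If $S_{\boldsymbol\lambda}\in\mathbf{B}(\ell^2(V))$ and $S_{\boldsymbol\lambda_{\mathscr{P}}}\in\mathbf{B}(\ell^2(V_{\mathscr{P}}))$ is reflexive, then $S_{\boldsymbol\lambda}$ is reflexive.
   Context: A rooted directed tree $\mathscr{T}=(V,E)$ has a unique vertex $\mathsf{root}$ without parent; every other vertex $v$ has a unique parent $\mathsf{par}(v)$; $V^\circ=V\setminus\{\mathsf{root}\}$. The tree is leafless if every vertex has at least one child. A path in $\mathscr{T}$ is a subgraph $\mathscr{P}=(V_{\mathscr{P}},E_{\mathscr{P}})$ of $\mathscr{T}$ which is itself a directed tree, contains $\mathsf{root}$, and in which every $v\in V_{\mathscr{P}}$ has exactly one child; $V_{\mathscr{P}}^\circ=V_{\mathscr{P}}\setminus\{\mathsf{root}\}$. $\ell^2(V)$ is the space of square-summable functions $V\to\mathbb{C}$. For a rooted directed tree with vertex set $V$ and weights $\boldsymbol\lambda=\{\lambda_v\}_{v\in V^\circ}$, the weighted shift $S_{\boldsymbol\lambda}$ is the operator in $\ell^2(V)$ given by $(S_{\boldsymbol\lambda}f)(v)=\lambda_vf(\mathsf{par}(v))$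 for $v\in V^\circ$ and $(S_{\boldsymbol\lambda}f)(\mathsf{root})=0$, on its maximal domain; $S_{\boldsymbol\lambda_{\mathscr{P}}}$ is the weighted shift on the tree $\mathscr{P}$ with weights $\boldsymbol\lambda_{\mathscr{P}}$. $\mathbf{B}(\cdot)$ denotes bounded everywhere defined operators. For $A\in\mathbf{B}(H)$, $H$ a Hilbert space, $\mathcal{W}(A)$ is the smallest subalgebra of $\mathbf{B}(H)$ containing $A$ and the identity and closed in the weak operator topology. For an algebra $\mathcal{W}\subseteq\mathbf{B}(H)$, $\mathrm{Lat}\,\mathcal{W}$ is the set of closed subspaces invariant under every element of $\mathcal{W}$; for a family $\mathfrak{M}$ of subspaces, $\mathrm{Alg}\,\mathfrak{M}$ is the set of operators in $\mathbf{B}(H)$ leaving every member of $\mathfrak{M}$ invariant. $A$ is reflexive if $\mathrm{Alg}\,\mathrm{Lat}\,\mathcal{W}(A)=\mathcal{W}(A)$. *)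

theory Defs
  imports "HOL-Analysis.Analysis" "Graph_Theory.Graph_Theory"
begin

section \<open>Rooted directed trees\<close>

definition is_root :: "'v pair_pre_digraph \<Rightarrow> 'v \<Rightarrow> bool" where
  "is_root T r \<longleftrightarrow> r \<in> pverts T \<and> (\<nexists>u. (u, r) \<in> parcs T)"

text \<open>\<^const>\<open>tree\<close> of a digraph means: nonempty, connected as an undirected graph, and without
  \<^emph>\<open>directed\<close> cycles (loops count as cycles).\<close>

definition directed_tree :: "'v pair_pre_digraph \<Rightarrow> bool" where
  "directed_tree T \<longleftrightarrow> pair_wf_digraph T \<and> tree (with_proj T) \<and>
     (\<forall>v\<in>pverts T. \<not> is_root T v \<longrightarrow> (\<exists>!u. (u, v) \<in> parcs T))"

definition rooted_directed_tree :: "'v pair_pre_digraph \<Rightarrow> bool" where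
  "rooted_directed_tree T \<longleftrightarrow> directed_tree T \<and> (\<exists>!r. is_root T r)"

definition tree_root :: "'v pair_pre_digraph \<Rightarrow> 'v" where
  "tree_root T = (THE r. is_root T r)"

definition par :: "'v pair_pre_digraph \<Rightarrow> 'v \<Rightarrow> 'v" where
  "par T v = (THE u. (u, v) \<in> parcs T)"

definition leafless :: "'v pair_pre_digraph \<Rightarrow> bool" where
  "leafless T \<longleftrightarrow> (\<forall>v\<in>pverts T. \<exists>w. (v, w) \<in> parcs T)"

definition tree_path :: "'v pair_pre_digraph \<Rightarrow> 'v pair_pre_digraph \<Rightarrow> bool" where
  "tree_path P T \<longleftrightarrow> subgraph (with_proj P) (with_proj T) \<and> directed_tree P \<and>
     tree_root T \<in> pverts P \<and> (\<forall>v\<in>pverts P. \<exists>!w. (v, w) \<in> parcs P)"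

section \<open>The Hilbert space of square-summable functions on a set\<close>

text \<open>A function on \<open>X\<close> is represented by its extension by zero to the whole type, so that the
  vector space operations are pointwise.\<close>

definition l2 :: "'v set \<Rightarrow> ('v \<Rightarrow> complex) set" where
  "l2 X = {f. (\<forall>v. v \<notin> X \<longrightarrow> f v = 0) \<and> (\<lambda>v. (cmod (f v))\<^sup>2) summable_on X}"

definition l2_inner :: "'v set \<Rightarrow> ('v \<Rightarrow> complex) \<Rightarrow> ('v \<Rightarrow> complex) \<Rightarrow> complex" where
  "l2_inner X f g = (\<Sum>\<^sub>\<infinity>v\<in>X. f v * cnj (g v))"

definition l2_norm :: "'v set \<Rightarrow> ('v \<Rightarrow> complex) \<Rightarrow> real" where
  "l2_norm X f = sqrt (\<Sum>\<^sub>\<infinity>v\<in>X. (cmod (f v))\<^sup>2)"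

definition l2_dist :: "'v set \<Rightarrow> ('v \<Rightarrow> complex) \<Rightarrow> ('v \<Rightarrow> complex) \<Rightarrow> real" where
  "l2_dist X f g = l2_norm X (\<lambda>v. f v - g v)"

section \<open>Bounded operators, and reflexivity\<close>

type_synonym 'v operator = "('v \<Rightarrow> complex) \<Rightarrow> ('v \<Rightarrow> complex)"

text \<open>Operators are \<^const>\<open>undefined\<close> outside their domain, so that equality of operators is
  equality of functions.\<close>

definition bounded_ops :: "'v set \<Rightarrow> 'v operator set" where
  "bounded_ops X = {A \<in> l2 X \<rightarrow>\<^sub>E l2 X.
     (\<forall>f\<in>l2 X. \<forall>g\<in>l2 X. A (\<lambda>v. f v + g v) = (\<lambda>v. A f v + A g v)) \<and>
     (\<forall>c. \<forall>f\<in>l2 X. A (\<lambda>v. c * f v) = (\<lambda>v. c * A f v)) \<and>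
     (\<exists>K. \<forall>f\<in>l2 X. l2_norm X (A f) \<le> K * l2_norm X f)}"

definition op_id :: "'v set \<Rightarrow> 'v operator" where
  "op_id X = (\<lambda>f\<in>l2 X. f)"

definition op_add :: "'v set \<Rightarrow> 'v operator \<Rightarrow> 'v operator \<Rightarrow> 'v operator" where
  "op_add X A B = (\<lambda>f\<in>l2 X. \<lambda>v. A f v + B f v)"

definition op_scale :: "'v set \<Rightarrow> complex \<Rightarrow> 'v operator \<Rightarrow> 'v operator" where
  "op_scale X c A = (\<lambda>f\<in>l2 X. \<lambda>v. c * A f v)"

definition unital_subalgebra :: "'v set \<Rightarrow> 'v operator set \<Rightarrow> bool" where
  "unital_subalgebra X W \<longleftrightarrow> W \<subseteq> bounded_ops X \<and> op_id X \<in> W \<and>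
     (\<forall>A\<in>W. \<forall>B\<in>W. op_add X A B \<in> W) \<and>
     (\<forall>c. \<forall>A\<in>W. op_scale X c A \<in> W) \<and>
     (\<forall>A\<in>W. \<forall>B\<in>W. compose (l2 X) A B \<in> W)"

text \<open>The weak operator topology: the coarsest topology on the bounded operators that makes all
  matrix coefficients \<open>A \<mapsto> \<langle>A f, g\<rangle>\<close> continuous.\<close>

definition wot :: "'v set \<Rightarrow> 'v operator topology" where
  "wot X = topology_generated_by
     {{A \<in> bounded_ops X. l2_inner X (A f) g \<in> U} | f g U. f \<in> l2 X \<and> g \<in> l2 X \<and> open U}"

definition wot_algebra :: "'v set \<Rightarrow> 'v operator \<Rightarrow> 'v operator set" where
  "wot_algebra X A = \<Inter>{W. unital_subalgebra X W \<and> A \<in> W \<and> closedin (wot X) W}"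

definition closed_subspace :: "'v set \<Rightarrow> ('v \<Rightarrow> complex) set \<Rightarrow> bool" where
  "closed_subspace X M \<longleftrightarrow>
     (\<lambda>_. 0) \<in> M \<and>
     (\<forall>f\<in>M. \<forall>g\<in>M. (\<lambda>v. f v + g v) \<in> M) \<and>
     (\<forall>c. \<forall>f\<in>M. (\<lambda>v. c * f v) \<in> M) \<and>
     closedin (Metric_space.mtopology (l2 X) (l2_dist X)) M"

definition Lat :: "'v set \<Rightarrow> 'v operator set \<Rightarrow> ('v \<Rightarrow> complex) set set" where
  "Lat X W = {M. closed_subspace X M \<and> (\<forall>A\<in>W. A ` M \<subseteq> M)}"

definition Alg :: "'v set \<Rightarrow> ('v \<Rightarrow> complex) set set \<Rightarrow> 'v operator set" where
  "Alg X \<MM> = {A \<in> bounded_ops X. \<forall>M\<in>\<MM>. A ` M \<subseteq> M}"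

definition reflexive_op :: "'v set \<Rightarrow> 'v operator \<Rightarrow> bool" where
  "reflexive_op X A \<longleftrightarrow> A \<in> bounded_ops X \<and> Alg X (Lat X (wot_algebra X A)) = wot_algebra X A"

section \<open>Weighted shifts\<close>

text \<open>Only the values of the weights at the non-root vertices of the tree matter; hence one weight
  function serves for a tree and for its subtrees.\<close>

definition shift_map :: "'v pair_pre_digraph \<Rightarrow> ('v \<Rightarrow> real) \<Rightarrow> 'v operator" where
  "shift_map T lam f =
     (\<lambda>v. if v \<in> pverts T - {tree_root T} then of_real (lam v) * f (par T v) else 0)"

definition wshift_dom :: "'v pair_pre_digraph \<Rightarrow> ('v \<Rightarrow> real) \<Rightarrow> ('v \<Rightarrow> complex) set" where
  "wshift_dom T lam = {f \<in> l2 (pverts T). shift_map T lam f \<in> l2 (pverts T)}"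

definition wshift :: "'v pair_pre_digraph \<Rightarrow> ('v \<Rightarrow> real) \<Rightarrow> 'v operator" where
  "wshift T lam = restrict (shift_map T lam) (wshift_dom T lam)"

section \<open>Consistency of the encodings\<close>

lemma tree_root_path:
  assumes T: "rooted_directed_tree T" and P: "tree_path P T"
  shows "rooted_directed_tree P" "tree_root P = tree_root T"
proof -
  have sub: "pverts P \<subseteq> pverts T" "parcs P \<subseteq> parcs T" and dP: "directed_tree P"
    and rP: "tree_root T \<in> pverts P"
    using P by (auto simp: tree_path_def subgraph_def)
  have rT: "is_root T (tree_root T)"
    using T theI'[of "is_root T"] by (simp add: rooted_directed_tree_def tree_root_def)
  then have r: "is_root P (tree_root T)"
    using sub rP by (auto simp: is_root_def)
  have uP: "\<exists>!u. (u, v) \<in> parcs P" if "v \<in> pverts P" "\<not> is_root P v" for v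
    using dP that by (simp add: directed_tree_def)
  have wfP: "pair_wf_digraph P" and "tree (with_proj P)"
    using dP by (auto simp: directed_tree_def)
  have uniq: "s = tree_root T" if s: "is_root P s" for s
  proof -
    let ?r = "tree_root T"
    have "(?r, s) \<in> rtrancl_on (pverts P) (parcs (mk_symmetric (with_proj P)))"
      using \<open>tree (with_proj P)\<close> s rP
      by (simp add: tree_def Digraph_Component.connected_def strongly_connected_def reachable_def
          is_root_def mk_symmetric_def)
    then have "(?r, s) \<in> (parcs (mk_symmetric (with_proj P)))\<^sup>*"
      by (simp add: rtrancl_on_rtranclI)
    moreover have "(?r, v) \<in> (parcs P)\<^sup>*"
      if "(?r, v) \<in> (parcs (mk_symmetric (with_proj P)))\<^sup>*" for v
      using that
    proof (induction rule: rtrancl_induct)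
      case base
      then show ?case by simp
    next
      case (step y z)
      from step.hyps(2) consider "(y, z) \<in> parcs P" | "(z, y) \<in> parcs P"
        by (auto simp: mk_symmetric_def)
      then show ?case
      proof cases
        case 1
        with step.IH show ?thesis by (rule rtrancl_into_rtrancl)
      next
        case 2
        have "y \<noteq> ?r"
          using 2 r by (auto simp: is_root_def)
        with step.IH obtain w where w: "(?r, w) \<in> (parcs P)\<^sup>*" "(w, y) \<in> parcs P"
          by (metis rtrancl.cases)
        moreover have "y \<in> pverts P" "\<not> is_root P y"
          using 2 wfP by (auto simp: is_root_def pair_wf_digraph_def)
        ultimately have "w = z"
          using uP 2 by blast
        with w show ?thesis by simp
      qed
    qed
    ultimately have "(?r, s) \<in> (parcs P)\<^sup>*" by blast
    then show ?thesis
      by (rule rtranclE) (use s in \<open>auto simp: is_root_def\<close>)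
  qed
  show "rooted_directed_tree P"
    unfolding rooted_directed_tree_def using dP r uniq by blast
  show "tree_root P = tree_root T"
    unfolding tree_root_def[of P] using r uniq by (rule the_equality)
qed

lemma zero_l2: "(\<lambda>_. 0) \<in> l2 X"
  by (simp add: l2_def)

lemma topspace_wot: "topspace (wot X) = bounded_ops X"
proof -
  have "bounded_ops X \<in>
      {{A \<in> bounded_ops X. l2_inner X (A f) g \<in> U} | f g U. f \<in> l2 X \<and> g \<in> l2 X \<and> open U}"
    unfolding mem_Collect_eq
    by (intro exI[of _ "\<lambda>_. 0"] exI[of _ UNIV]) (simp add: zero_l2)
  then show ?thesis
    unfolding wot_def topology_generated_by_topspace by blast
qed

lemma l2_norm_triangle:
  assumes f: "f \<in> l2 X" and g: "g \<in> l2 X"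
  shows "(\<lambda>v. f v + g v) \<in> l2 X"
    and "l2_norm X (\<lambda>v. f v + g v) \<le> l2_norm X f + l2_norm X g"
proof -
  have sf: "(\<lambda>v. (cmod (f v))\<^sup>2) summable_on X" and sg: "(\<lambda>v. (cmod (g v))\<^sup>2) summable_on X"
    using f g by (auto simp: l2_def)
  let ?N = "l2_norm X f + l2_norm X g"
  have fin: "(\<Sum>v\<in>F. (cmod (f v + g v))\<^sup>2) \<le> ?N\<^sup>2" if F: "finite F" "F \<subseteq> X" for F
  proof -
    have le: "L2_set (\<lambda>v. cmod (h v)) F \<le> l2_norm X h"
      if "(\<lambda>v. (cmod (h v))\<^sup>2) summable_on X" for h
      using finite_sum_le_infsum[OF that F] by (simp add: L2_set_def l2_norm_def)
    have "L2_set (\<lambda>v. cmod (f v + g v)) F \<le> L2_set (\<lambda>v. cmod (f v) + cmod (g v)) F"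
      by (intro L2_set_mono norm_triangle_ineq) auto
    also have "\<dots> \<le> L2_set (\<lambda>v. cmod (f v)) F + L2_set (\<lambda>v. cmod (g v)) F"
      by (rule L2_set_triangle_ineq)
    also have "\<dots> \<le> ?N"
      using le[OF sf] le[OF sg] by simp
    finally have "sqrt (\<Sum>v\<in>F. (cmod (f v + g v))\<^sup>2) \<le> ?N"
      by (simp add: L2_set_def)
    then show ?thesis
      by (rule sqrt_le_D)
  qed
  have s: "(\<lambda>v. (cmod (f v + g v))\<^sup>2) summable_on X"
    by (rule nonneg_bdd_above_summable_on) (use fin in \<open>auto intro!: bdd_aboveI[of _ "?N\<^sup>2"]\<close>)
  then show "(\<lambda>v. f v + g v) \<in> l2 X"
    using f g by (simp add: l2_def)
  have "(\<Sum>\<^sub>\<infinity>v\<in>X. (cmod (f v + g v))\<^sup>2) \<le> ?N\<^sup>2"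
    by (rule infsum_le_finite_sums[OF s]) (use fin in auto)
  moreover have "?N \<ge> 0"
    by (simp add: l2_norm_def infsum_nonneg)
  ultimately show "l2_norm X (\<lambda>v. f v + g v) \<le> ?N"
    unfolding l2_norm_def[of X "\<lambda>v. f v + g v"] by (rule real_le_lsqrt[rotated])
qed

lemma Metric_space_l2: "Metric_space (l2 X) (l2_dist X)"
proof
  have diff: "(\<lambda>v. f v - g v) \<in> l2 X" if "f \<in> l2 X" "g \<in> l2 X" for f g
  proof -
    have "(\<lambda>v. - g v) \<in> l2 X"
      using that by (simp add: l2_def)
    from l2_norm_triangle(1)[OF that(1) this] show ?thesis
      by simp
  qed
  fix f g h :: "'a \<Rightarrow> complex"
  show "0 \<le> l2_dist X f g"
    by (simp add: l2_dist_def l2_norm_def infsum_nonneg)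
  show "l2_dist X f g = l2_dist X g f"
    by (simp add: l2_dist_def l2_norm_def norm_minus_commute)
  show "l2_dist X f g = 0 \<longleftrightarrow> f = g" if "f \<in> l2 X" "g \<in> l2 X"
  proof
    assume "l2_dist X f g = 0"
    then have 0: "(\<Sum>\<^sub>\<infinity>v\<in>X. (cmod (f v - g v))\<^sup>2) = 0"
      by (simp add: l2_dist_def l2_norm_def)
    have "(\<lambda>v. (cmod (f v - g v))\<^sup>2) summable_on X"
      using diff[OF that] by (simp add: l2_def)
    then have "(cmod (f v - g v))\<^sup>2 = 0" if "v \<in> X" for v
      using nonneg_infsum_le_0D[of "\<lambda>v. (cmod (f v - g v))\<^sup>2" X v] 0 that by simp
    then have "f v = g v" for v
      using that by (cases "v \<in> X") (auto simp: l2_def)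
    then show "f = g" ..
  next
    assume "f = g"
    then show "l2_dist X f g = 0"
      by (simp add: l2_dist_def l2_norm_def)
  qed
  show "l2_dist X f h \<le> l2_dist X f g + l2_dist X g h"
    if "f \<in> l2 X" "g \<in> l2 X" "h \<in> l2 X"
    using l2_norm_triangle(2)[OF diff[OF that(1,2)] diff[OF that(2,3)]]
    by (simp add: l2_dist_def)
qed

end

theory Submission
  imports Defs
begin

text \<open>Let \<open>A\<close> be in \<open>Alg Lat W(S)\<close>. For vertices \<open>x, y\<close> on the same level, the functions that are on each
  level proportional to the orbit of \<open>e\<^sub>x\<close>, or of \<open>e\<^sub>x + e\<^sub>y\<close>, form an invariant subspace of \<open>S\<close>. Hence
  \<open>A e\<^sub>x\<close> is the orbit of \<open>e\<^sub>x\<close>, multiplied on level \<open>m\<close> by a factor \<open>a(|x|, m)\<close> that depends on \<open>x\<close>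
  only through its level. The compression of \<open>A\<close> to the path is in \<open>Alg Lat W(S\<^sub>P) = W(S\<^sub>P)\<close>, so it
  commutes with \<open>S\<^sub>P\<close>, which forces \<open>a(|x|, m) = \<phi>(m - |x|)\<close>. Thus \<open>A\<close> acts as the formal power
  series with coefficients \<open>\<phi>\<close> in \<open>S\<close>. Its Cesaro means are polynomials in \<open>S\<close> of norm at most that
  of \<open>A\<close> and converge to \<open>A\<close> coordinatewise, therefore weakly.\<close>

section \<open>Square-summable functions\<close>

text \<open>The invariant subspaces built from orbits leave the factors of different levels
  unrelated; the reflexivity of the path shift enters only to relate them. One path settles the
  whole tree because it meets every level and the factors depend on the level only. The sums
  \<open>e\<^sub>x + e\<^sub>y\<close> give that dependence: distinct vertices of a level have
  disjoint orbits, and leaflessness keeps each orbit nonzero on all deeper levels, so the factor of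
  the sum is the factor of either summand. Functions supported on the path are not invariant under S
  when path vertices have further children, but functions vanishing on the path are, since the
  parent of a path vertex is on the path. This makes compression multiplicative on W(S), and it is
  why invariant subspaces of the path shift are pulled back along the cutoff. Partial sums of the
  power series need not be bounded in norm, so Cesaro means take their place.\<close>

definition cutoff :: "('v \<Rightarrow> bool) \<Rightarrow> ('v \<Rightarrow> complex) \<Rightarrow> 'v \<Rightarrow> complex" where
  "cutoff Q f = (\<lambda>v. if Q v then f v else 0)"

definition delta :: "'v \<Rightarrow> 'v \<Rightarrow> complex" where
  "delta x = (\<lambda>v. if v = x then 1 else 0)"

lemma l2_norm_nonneg: "0 \<le> l2_norm X f"
  by (simp add: l2_norm_def infsum_nonneg)

lemma l2_eq_0: "f \<in> l2 X \<Longrightarrow> v \<notin> X \<Longrightarrow> f v = 0"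
  by (simp add: l2_def)

lemma l2_finite_sum_le:
  assumes "f \<in> l2 X" "finite F"
  shows "(\<Sum>v\<in>F. (cmod (f v))\<^sup>2) \<le> (l2_norm X f)\<^sup>2"
proof -
  have "(\<Sum>v\<in>F. (cmod (f v))\<^sup>2) = (\<Sum>v\<in>F \<inter> X. (cmod (f v))\<^sup>2)"
    using assms by (intro sum.mono_neutral_right) (auto simp: l2_def)
  also have "\<dots> \<le> (\<Sum>\<^sub>\<infinity>v\<in>X. (cmod (f v))\<^sup>2)"
    using assms by (intro finite_sum_le_infsum) (auto simp: l2_def)
  finally show ?thesis
    by (simp add: l2_norm_def infsum_nonneg)
qed

text \<open>With \<open>l2_finite_sum_le\<close> as converse, this reduces norm estimates to finite
  sums.\<close>

lemma l2_finite_boundI: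
  assumes zero: "\<And>v. v \<notin> X \<Longrightarrow> f v = 0"
    and le: "\<And>F. finite F \<Longrightarrow> F \<subseteq> X \<Longrightarrow> (\<Sum>v\<in>F. (cmod (f v))\<^sup>2) \<le> C\<^sup>2"
    and C: "0 \<le> C"
  shows "f \<in> l2 X" "l2_norm X f \<le> C"
proof -
  have s: "(\<lambda>v. (cmod (f v))\<^sup>2) summable_on X"
    by (rule nonneg_bdd_above_summable_on) (use le in \<open>auto intro!: bdd_aboveI[of _ "C\<^sup>2"]\<close>)
  then show "f \<in> l2 X"
    using zero by (simp add: l2_def)
  have "(\<Sum>\<^sub>\<infinity>v\<in>X. (cmod (f v))\<^sup>2) \<le> C\<^sup>2"
    by (rule infsum_le_finite_sums[OF s]) (use le in auto)
  then show "l2_norm X f \<le> C"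
    unfolding l2_norm_def using C by (rule real_le_lsqrt[rotated])
qed

lemma l2_coord_le:
  assumes "f \<in> l2 X"
  shows "cmod (f v) \<le> l2_norm X f"
  using l2_finite_sum_le[OF assms, of "{v}"]
  by (simp add: l2_norm_nonneg power2_le_iff_abs_le)

lemma l2_scale:
  assumes "f \<in> l2 X"
  shows "(\<lambda>v. c * f v) \<in> l2 X"
    and "l2_norm X (\<lambda>v. c * f v) \<le> cmod c * l2_norm X f"
proof -
  have "(\<Sum>v\<in>F. (cmod (c * f v))\<^sup>2) \<le> (cmod c * l2_norm X f)\<^sup>2" if "finite F" for F
    using l2_finite_sum_le[OF assms that]
    by (simp add: norm_mult power_mult_distrib mult_left_mono flip: sum_distrib_left)
  then show "(\<lambda>v. c * f v) \<in> l2 X" "l2_norm X (\<lambda>v. c * f v) \<le> cmod c * l2_norm X f"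
    using assms
    by (auto intro!: l2_finite_boundI[of X _ "cmod c * l2_norm X f"] simp: l2_eq_0 l2_norm_nonneg)
qed

lemmas l2_add = l2_norm_triangle(1)

lemma l2_diff:
  assumes "f \<in> l2 X" "g \<in> l2 X"
  shows "(\<lambda>v. f v - g v) \<in> l2 X"
  using l2_add[OF assms(1) l2_scale(1)[OF assms(2), of "-1"]] by simp

lemma l2_cutoff:
  assumes "f \<in> l2 X"
  shows "cutoff Q f \<in> l2 X"
    and "l2_norm X (cutoff Q f) \<le> l2_norm X f"
proof -
  have "(\<Sum>v\<in>F. (cmod (cutoff Q f v))\<^sup>2) \<le> (l2_norm X f)\<^sup>2" if "finite F" for F
  proof -
    have "(\<Sum>v\<in>F. (cmod (cutoff Q f v))\<^sup>2) \<le> (\<Sum>v\<in>F. (cmod (f v))\<^sup>2)"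
      by (intro sum_mono) (simp add: cutoff_def)
    then show ?thesis
      using l2_finite_sum_le[OF assms that] by simp
  qed
  then show "cutoff Q f \<in> l2 X" "l2_norm X (cutoff Q f) \<le> l2_norm X f"
    using assms
    by (auto intro!: l2_finite_boundI[of X _ "l2_norm X f"] simp: l2_eq_0 cutoff_def l2_norm_nonneg)
qed

lemma delta_l2:
  assumes "x \<in> X"
  shows "delta x \<in> l2 X"
proof (rule l2_finite_boundI(1))
  show "(\<Sum>v\<in>F. (cmod (delta x v))\<^sup>2) \<le> 1\<^sup>2" if "finite F" for F
  proof -
    have "(\<Sum>v\<in>F. (cmod (delta x v))\<^sup>2) = (\<Sum>v\<in>F. if v = x then 1 else 0)"
      by (intro sum.cong) (auto simp: delta_def)
    then show ?thesis
      using that by simp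
  qed
qed (use assms in \<open>auto simp: delta_def\<close>)

lemma l2_superset:
  assumes "X \<subseteq> Y" "f \<in> l2 X"
  shows "f \<in> l2 Y" "l2_norm Y f = l2_norm X f"
proof -
  have "(\<Sum>v\<in>F. (cmod (f v))\<^sup>2) \<le> (l2_norm X f)\<^sup>2" if "finite F" for F
    using l2_finite_sum_le[OF assms(2) that] .
  then show "f \<in> l2 Y"
    using assms
    by (intro l2_finite_boundI(1)[of Y f "l2_norm X f"]) (auto intro: l2_eq_0 simp: l2_norm_nonneg)
  have "(\<Sum>\<^sub>\<infinity>v\<in>Y. (cmod (f v))\<^sup>2) = (\<Sum>\<^sub>\<infinity>v\<in>X. (cmod (f v))\<^sup>2)"
    using assms by (intro infsum_cong_neutral) (auto simp: l2_eq_0)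
  then show "l2_norm Y f = l2_norm X f"
    by (simp add: l2_norm_def)
qed

lemma l2_cutoff_subset:
  assumes "X \<subseteq> Y" "f \<in> l2 Y"
  shows "cutoff (\<lambda>v. v \<in> X) f \<in> l2 X" "l2_norm X (cutoff (\<lambda>v. v \<in> X) f) \<le> l2_norm Y f"
proof -
  have "(\<Sum>v\<in>F. (cmod (cutoff (\<lambda>v. v \<in> X) f v))\<^sup>2) \<le> (l2_norm Y f)\<^sup>2" if "finite F" "F \<subseteq> X" for F
    using l2_finite_sum_le[OF assms(2) that(1)] that(2)
    by (simp add: cutoff_def subset_iff cong: sum.cong)
  then show "cutoff (\<lambda>v. v \<in> X) f \<in> l2 X" "l2_norm X (cutoff (\<lambda>v. v \<in> X) f) \<le> l2_norm Y f"
    by (auto intro!: l2_finite_boundI[of X _ "l2_norm Y f"] simp: cutoff_def l2_norm_nonneg)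
qed

section \<open>Inner products and weak convergence of bounded sequences\<close>

lemma l2_inner_summable:
  assumes f: "(\<lambda>v. (cmod (f v))\<^sup>2) summable_on Y" and g: "(\<lambda>v. (cmod (g v))\<^sup>2) summable_on Y"
  shows "(\<lambda>v. f v * cnj (g v)) summable_on Y"
    and "cmod (l2_inner Y f g) \<le> l2_norm Y f * l2_norm Y g"
proof -
  have le: "L2_set (\<lambda>v. cmod (h v)) F \<le> l2_norm Y h"
    if "(\<lambda>v. (cmod (h v))\<^sup>2) summable_on Y" "finite F" "F \<subseteq> Y" for h F
    using finite_sum_le_infsum[OF that] by (simp add: L2_set_def l2_norm_def)
  have fin: "(\<Sum>v\<in>F. cmod (f v * cnj (g v))) \<le> l2_norm Y f * l2_norm Y g"
    if F: "finite F" "F \<subseteq> Y" for F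
  proof -
    have "(\<Sum>v\<in>F. cmod (f v * cnj (g v))) \<le> L2_set (\<lambda>v. cmod (f v)) F * L2_set (\<lambda>v. cmod (g v)) F"
      using L2_set_mult_ineq[of "\<lambda>v. cmod (f v)" "\<lambda>v. cmod (g v)" F] by (simp add: norm_mult)
    also have "\<dots> \<le> l2_norm Y f * l2_norm Y g"
      using le[OF f F] le[OF g F] by (intro mult_mono) (auto simp: l2_norm_nonneg L2_set_nonneg)
    finally show ?thesis .
  qed
  have abs: "(\<lambda>v. norm (f v * cnj (g v))) summable_on Y"
    by (rule nonneg_bdd_above_summable_on)
      (use fin in \<open>auto intro!: bdd_aboveI[of _ "l2_norm Y f * l2_norm Y g"]\<close>)
  then show "(\<lambda>v. f v * cnj (g v)) summable_on Y"
    by (rule abs_summable_summable)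
  have "cmod (l2_inner Y f g) \<le> (\<Sum>\<^sub>\<infinity>v\<in>Y. cmod (f v * cnj (g v)))"
    unfolding l2_inner_def by (rule norm_infsum_bound[OF abs])
  also have "\<dots> \<le> l2_norm Y f * l2_norm Y g"
    by (rule infsum_le_finite_sums[OF abs]) (use fin in auto)
  finally show "cmod (l2_inner Y f g) \<le> l2_norm Y f * l2_norm Y g" .
qed

lemma l2_inner_delta:
  assumes "x \<in> X"
  shows "l2_inner X f (delta x) = f x"
proof -
  have "l2_inner X f (delta x) = (\<Sum>\<^sub>\<infinity>v\<in>{x}. f v * cnj (delta x v))"
    unfolding l2_inner_def using assms by (intro infsum_cong_neutral) (auto simp: delta_def)
  then show ?thesis
    by (simp add: delta_def)
qed

lemma l2_inner_superset:
  assumes "X \<subseteq> Y" "g \<in> l2 X"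
  shows "l2_inner Y f g = l2_inner X f g"
  unfolding l2_inner_def using assms by (intro infsum_cong_neutral) (auto simp: l2_eq_0)

text \<open>A finite set \<open>F\<close> carries \<open>g\<close> up to a small tail. On
  \<open>F\<close> finitely many coordinates converge, and off \<open>F\<close> Cauchy-Schwarz plays
  the norm bound against the tail of \<open>g\<close>.\<close>

lemma l2_inner_tendsto:
  assumes h: "\<And>n. h n \<in> l2 X" "\<And>n. l2_norm X (h n) \<le> K" and l: "l \<in> l2 X"
    and lim: "\<And>v. v \<in> X \<Longrightarrow> (\<lambda>n. h n v) \<longlonglongrightarrow> l v" and g: "g \<in> l2 X"
  shows "(\<lambda>n. l2_inner X (h n) g) \<longlonglongrightarrow> l2_inner X l g"
proof (rule LIMSEQ_I)
  fix e :: real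
  assume e: "0 < e"
  \<comment> \<open>\<open>K + l2_norm X l\<close> already bounds the differences
    \<open>h n - l\<close>; the added 1 keeps the divisor in the tail tolerance positive.\<close>
  define K' where "K' = K + l2_norm X l + 1"
  have K0: "0 \<le> K"
    using h(2)[of 0] l2_norm_nonneg[of X "h 0"] by linarith
  then have K': "0 < K'"
    using l2_norm_nonneg[of X l] by (simp add: K'_def)
  define q where "q n = (\<lambda>v. h n v - l v)" for n
  have q: "q n \<in> l2 X" "l2_norm X (q n) \<le> K'" for n
  proof -
    show "q n \<in> l2 X"
      using h(1) l by (simp add: q_def l2_diff)
    show "l2_norm X (q n) \<le> K'"
      using l2_norm_triangle(2)[OF h(1)[of n] l2_scale(1)[OF l, of "-1"]] h(2)[of n] l2_scale(2)[OF l, of "-1"]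
      by (simp add: q_def K'_def)
  qed
  have sg: "(\<lambda>v. (cmod (g v))\<^sup>2) summable_on X"
    using g by (simp add: l2_def)
  obtain F where F: "finite F" "F \<subseteq> X"
    and Fd: "dist (\<Sum>v\<in>F. (cmod (g v))\<^sup>2) (\<Sum>\<^sub>\<infinity>v\<in>X. (cmod (g v))\<^sup>2) \<le> (e / (2 * K'))\<^sup>2"
    using infsum_finite_approximation[OF sg, of "(e / (2 * K'))\<^sup>2"] e K' by auto
  have s': "(\<lambda>v. (cmod (f v))\<^sup>2) summable_on (X - F)" if "f \<in> l2 X" for f
    using that by (auto simp: l2_def intro: summable_on_subset_banach)
  have "(\<Sum>\<^sub>\<infinity>v\<in>X - F. (cmod (g v))\<^sup>2) \<le> (e / (2 * K'))\<^sup>2"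
    using Fd infsum_Diff[OF sg _ F(2)] F by (simp add: dist_real_def)
  then have tail: "l2_norm (X - F) g \<le> e / (2 * K')"
    unfolding l2_norm_def using e K' by (intro real_le_lsqrt) auto
  have qX: "l2_norm (X - F) (q n) \<le> K'" for n
  proof -
    have "l2_norm (X - F) (q n) \<le> l2_norm X (q n)"
      unfolding l2_norm_def
      using q(1)[of n] s'[OF q(1)] by (intro real_sqrt_le_mono infsum_mono_neutral) (auto simp: l2_def)
    then show ?thesis
      using q(2)[of n] by simp
  qed
  have split: "l2_inner X (q n) g = (\<Sum>v\<in>F. q n v * cnj (g v)) + l2_inner (X - F) (q n) g" for n
  proof -
    have "(\<lambda>v. q n v * cnj (g v)) summable_on X"
      using q(1)[of n] g by (intro l2_inner_summable) (auto simp: l2_def)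
    then show ?thesis
      unfolding l2_inner_def using infsum_Diff[of "\<lambda>v. q n v * cnj (g v)" X F] F by simp
  qed
  have "(\<lambda>n. \<Sum>v\<in>F. q n v * cnj (g v)) \<longlonglongrightarrow> (\<Sum>v\<in>F. 0 * cnj (g v))"
    unfolding q_def using lim F(2) by (intro tendsto_intros) (auto simp: LIM_zero_iff subset_iff)
  then have "(\<lambda>n. \<Sum>v\<in>F. q n v * cnj (g v)) \<longlonglongrightarrow> 0"
    by simp
  then obtain N where N: "\<And>n. n \<ge> N \<Longrightarrow> cmod (\<Sum>v\<in>F. q n v * cnj (g v)) < e / 2"
    using LIMSEQ_D[of _ 0 "e / 2"] e by auto
  have "cmod (l2_inner X (h n) g - l2_inner X l g) < e" if "n \<ge> N" for n
  proof -
    have "l2_inner X (h n) g - l2_inner X l g = l2_inner X (q n) g"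
    proof -
      have "(\<lambda>v. f v * cnj (g v)) summable_on X" if "f \<in> l2 X" for f
        using that g by (intro l2_inner_summable) (auto simp: l2_def)
      from infsum_add[OF this[OF q(1)[of n]] this[OF l]] show ?thesis
        unfolding l2_inner_def by (simp add: q_def left_diff_distrib)
    qed
    moreover have "cmod (l2_inner (X - F) (q n) g) \<le> K' * (e / (2 * K'))"
    proof -
      have "cmod (l2_inner (X - F) (q n) g) \<le> l2_norm (X - F) (q n) * l2_norm (X - F) g"
        using s'[OF q(1)[of n]] s'[OF g] by (rule l2_inner_summable)
      also have "\<dots> \<le> K' * (e / (2 * K'))"
        using qX[of n] tail K' by (intro mult_mono) (auto simp: l2_norm_nonneg)
      finally show ?thesis .
    qed
    moreover have "K' * (e / (2 * K')) = e / 2"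
      using K' by simp
    ultimately show ?thesis
      using N[OF that] norm_triangle_ineq[of "\<Sum>v\<in>F. q n v * cnj (g v)" "l2_inner (X - F) (q n) g"]
      by (simp add: split)
  qed
  then show "\<exists>no. \<forall>n\<ge>no. norm (l2_inner X (h n) g - l2_inner X l g) < e"
    by blast
qed

text \<open>The cutoff is a linear contraction from \<open>l2 Y\<close> to \<open>l2 X\<close>, so
  preimages of closed subspaces are closed subspaces.\<close>

lemma closed_subspace_cutoff:
  assumes "X \<subseteq> Y" "closed_subspace X N"
  shows "closed_subspace Y {f \<in> l2 Y. cutoff (\<lambda>v. v \<in> X) f \<in> N}"
proof -
  interpret X: Metric_space "l2 X" "l2_dist X" by (rule Metric_space_l2)
  interpret Y: Metric_space "l2 Y" "l2_dist Y" by (rule Metric_space_l2)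
  let ?c = "cutoff (\<lambda>v. v \<in> X)" 
  let ?M = "{f \<in> l2 Y. ?c f \<in> N}"
  have N: "(\<lambda>_. 0) \<in> N" "\<And>f g. f \<in> N \<Longrightarrow> g \<in> N \<Longrightarrow> (\<lambda>v. f v + g v) \<in> N"
    "\<And>c f. f \<in> N \<Longrightarrow> (\<lambda>v. c * f v) \<in> N" "closedin X.mtopology N"
    using assms(2) by (auto simp: closed_subspace_def)
  have c0: "?c (\<lambda>_. 0) = (\<lambda>_. 0)" and c1: "\<And>f g. ?c (\<lambda>v. f v + g v) = (\<lambda>v. ?c f v + ?c g v)"
    and c2: "\<And>a f. ?c (\<lambda>v. a * f v) = (\<lambda>v. a * ?c f v)"
    and c3: "\<And>f g. ?c (\<lambda>v. f v - g v) = (\<lambda>v. ?c f v - ?c g v)"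
    by (auto simp: cutoff_def)
  have "closedin Y.mtopology ?M"
    unfolding Y.metric_closedin_iff_sequentially_closed
  proof (intro conjI allI impI)
    fix \<sigma> l
    assume *: "range \<sigma> \<subseteq> ?M \<and> limitin Y.mtopology \<sigma> l sequentially"
    then have l: "l \<in> l2 Y"
      by (auto simp: Y.limitin_metric)
    have \<sigma>: "\<sigma> n \<in> l2 Y" "?c (\<sigma> n) \<in> N" for n
      using * by auto
    have le: "l2_dist X (?c (\<sigma> n)) (?c l) \<le> l2_dist Y (\<sigma> n) l" for n
      unfolding l2_dist_def c3[symmetric] by (intro l2_cutoff_subset assms(1) l2_diff \<sigma> l)
    have "limitin X.mtopology (\<lambda>n. ?c (\<sigma> n)) (?c l) sequentially"
      unfolding X.limitin_metric
    proof (intro conjI allI impI)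
      fix e :: real assume "0 < e"
      then have "eventually (\<lambda>n. \<sigma> n \<in> l2 Y \<and> l2_dist Y (\<sigma> n) l < e) sequentially"
        using * by (auto simp: Y.limitin_metric)
      then show "eventually (\<lambda>n. ?c (\<sigma> n) \<in> l2 X \<and> l2_dist X (?c (\<sigma> n)) (?c l) < e) sequentially"
        by eventually_elim (use le l2_cutoff_subset(1)[OF assms(1)] in \<open>auto intro: le_less_trans\<close>)
    qed (use l2_cutoff_subset(1)[OF assms(1)] l in auto)
    then have "?c l \<in> N"
      by (rule limitin_closedin[OF _ N(4)]) (simp_all add: \<sigma>(2))
    then show "l \<in> ?M"
      using l by simp
  qed auto
  then show ?thesis
    unfolding closed_subspace_def using N(1-3) by (auto simp: c0 c1 c2 zero_l2 l2_add l2_scale(1))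
qed

text \<open>The invariant subspaces of the argument are cut out by relations \<open>a * f x = b * f y\<close>
  between coordinates; closedness of such sets only needs continuity of the coordinates.\<close>

definition coord_space :: "'v set \<Rightarrow> (complex \<times> 'v \<times> complex \<times> 'v) set \<Rightarrow> ('v \<Rightarrow> complex) set" where
  "coord_space X C = {f \<in> l2 X. \<forall>(a, x, b, y)\<in>C. a * f x = b * f y}"

lemma closed_subspace_coord_space: "closed_subspace X (coord_space X C)"
proof -
  interpret Metric_space "l2 X" "l2_dist X" by (rule Metric_space_l2)
  have "closedin mtopology (coord_space X C)"
    unfolding metric_closedin_iff_sequentially_closed
  proof (intro conjI allI impI)
    fix \<sigma> l
    assume *: "range \<sigma> \<subseteq> coord_space X C \<and> limitin mtopology \<sigma> l sequentially"
    then have l: "l \<in> l2 X"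
      by (auto simp: limitin_metric)
    have \<sigma>: "\<sigma> n \<in> l2 X" "a * \<sigma> n x = b * \<sigma> n y" if "(a, x, b, y) \<in> C" for n a x b y
      using * that by (auto simp: coord_space_def image_subset_iff)
    have lim: "(\<lambda>n. \<sigma> n v) \<longlonglongrightarrow> l v" for v
    proof (rule tendstoI)
      fix e :: real assume "0 < e"
      then have "eventually (\<lambda>n. \<sigma> n \<in> l2 X \<and> l2_dist X (\<sigma> n) l < e) sequentially"
        using * by (auto simp: limitin_metric)
      then show "eventually (\<lambda>n. dist (\<sigma> n v) (l v) < e) sequentially"
      proof eventually_elim
        case (elim n)
        then show ?case
          using l2_coord_le[OF l2_diff[of "\<sigma> n" X l], of v] l by (simp add: l2_dist_def dist_norm)
      qed
    qed
    have "a * l x = b * l y" if "(a, x, b, y) \<in> C" for a x b y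
    proof (rule LIMSEQ_unique)
      show "(\<lambda>n. a * \<sigma> n x) \<longlonglongrightarrow> a * l x"
        by (intro tendsto_intros lim)
      show "(\<lambda>n. a * \<sigma> n x) \<longlonglongrightarrow> b * l y"
        unfolding \<sigma>(2)[OF that] by (intro tendsto_intros lim)
    qed
    then show "l \<in> coord_space X C"
      using l by (auto simp: coord_space_def)
  qed (auto simp: coord_space_def)
  then show ?thesis
    unfolding closed_subspace_def
  proof (intro conjI ballI allI)
    show "(\<lambda>_. 0) \<in> coord_space X C"
      by (auto simp: coord_space_def zero_l2)
    show "(\<lambda>v. f v + g v) \<in> coord_space X C"
      if "f \<in> coord_space X C" "g \<in> coord_space X C" for f g
      using that by (fastforce simp: coord_space_def l2_add distrib_left)
    show "(\<lambda>v. c * f v) \<in> coord_space X C" if "f \<in> coord_space X C" for c f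
    proof -
      have "a * (c * f x) = b * (c * f y)" if "(a, x, b, y) \<in> C" for a x b y
      proof -
        have "a * f x = b * f y"
          using \<open>f \<in> coord_space X C\<close> that by (auto simp: coord_space_def)
        then show ?thesis
          by (metis mult.left_commute)
      qed
      then show ?thesis
        using that by (auto simp: coord_space_def l2_scale(1))
    qed
  qed
qed

section \<open>Bounded operators and the weak operator topology\<close>

lemma
  assumes "A \<in> bounded_ops X"
  shows bounded_ops_l2: "f \<in> l2 X \<Longrightarrow> A f \<in> l2 X"
    and bounded_ops_add: "f \<in> l2 X \<Longrightarrow> g \<in> l2 X \<Longrightarrow> A (\<lambda>v. f v + g v) = (\<lambda>v. A f v + A g v)"
    and bounded_ops_scale: "f \<in> l2 X \<Longrightarrow> A (\<lambda>v. c * f v) = (\<lambda>v. c * A f v)"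
    and bounded_ops_ext: "A \<in> extensional (l2 X)"
  using assms by (auto simp: bounded_ops_def PiE_iff)

lemma bounded_ops_bound:
  assumes "A \<in> bounded_ops X"
  obtains K where "0 \<le> K" "\<And>f. f \<in> l2 X \<Longrightarrow> l2_norm X (A f) \<le> K * l2_norm X f"
proof -
  obtain K where K: "\<And>f. f \<in> l2 X \<Longrightarrow> l2_norm X (A f) \<le> K * l2_norm X f"
    using assms unfolding bounded_ops_def by blast
  show ?thesis
  proof (rule that[of "\<bar>K\<bar>"])
    show "l2_norm X (A f) \<le> \<bar>K\<bar> * l2_norm X f" if "f \<in> l2 X" for f
      using K[OF that] mult_right_mono[OF abs_ge_self l2_norm_nonneg, of K X f] by linarith
  qed simp
qed

lemma bounded_opsI:
  assumes "\<And>f. f \<in> l2 X \<Longrightarrow> A f \<in> l2 X" "A \<in> extensional (l2 X)"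
    and "\<And>f g. f \<in> l2 X \<Longrightarrow> g \<in> l2 X \<Longrightarrow> A (\<lambda>v. f v + g v) = (\<lambda>v. A f v + A g v)"
    and "\<And>c f. f \<in> l2 X \<Longrightarrow> A (\<lambda>v. c * f v) = (\<lambda>v. c * A f v)"
    and "\<And>f. f \<in> l2 X \<Longrightarrow> l2_norm X (A f) \<le> K * l2_norm X f"
  shows "A \<in> bounded_ops X"
proof -
  have "A \<in> l2 X \<rightarrow>\<^sub>E l2 X"
    using assms(1,2) by (simp add: PiE_iff)
  then show ?thesis
    using assms(3-) unfolding bounded_ops_def by blast
qed

lemma op_id_bounded: "op_id X \<in> bounded_ops X"
  by (rule bounded_opsI[where K = 1]) (auto simp: op_id_def l2_add l2_scale(1))

lemma op_add_bounded:
  assumes A: "A \<in> bounded_ops X" and B: "B \<in> bounded_ops X"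
  shows "op_add X A B \<in> bounded_ops X"
proof -
  obtain K where K: "\<And>f. f \<in> l2 X \<Longrightarrow> l2_norm X (A f) \<le> K * l2_norm X f"
    using bounded_ops_bound[OF A] by blast
  obtain L where L: "\<And>f. f \<in> l2 X \<Longrightarrow> l2_norm X (B f) \<le> L * l2_norm X f"
    using bounded_ops_bound[OF B] by blast
  show ?thesis
  proof (rule bounded_opsI[where K = "K + L"])
    fix f assume f: "f \<in> l2 X"
    show "op_add X A B f \<in> l2 X"
      using f A B by (simp add: op_add_def bounded_ops_l2 l2_add)
    show "l2_norm X (op_add X A B f) \<le> (K + L) * l2_norm X f"
      using f K[OF f] L[OF f] l2_norm_triangle(2)[OF bounded_ops_l2[OF A f] bounded_ops_l2[OF B f]]
      by (simp add: op_add_def distrib_right)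
    show "op_add X A B (\<lambda>v. c * f v) = (\<lambda>v. c * op_add X A B f v)" for c
      using f A B by (simp add: op_add_def l2_scale(1) bounded_ops_scale distrib_left)
    show "op_add X A B (\<lambda>v. f v + g v) = (\<lambda>v. op_add X A B f v + op_add X A B g v)"
      if "g \<in> l2 X" for g
      using f that A B by (simp add: op_add_def l2_add bounded_ops_add add_ac)
  qed (auto simp: op_add_def)
qed

lemma op_scale_bounded:
  assumes A: "A \<in> bounded_ops X"
  shows "op_scale X c A \<in> bounded_ops X"
proof -
  obtain K where K: "\<And>f. f \<in> l2 X \<Longrightarrow> l2_norm X (A f) \<le> K * l2_norm X f"
    using bounded_ops_bound[OF A] by blast
  show ?thesis
  proof (rule bounded_opsI[where K = "cmod c * K"])
    fix f assume f: "f \<in> l2 X"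
    show "op_scale X c A f \<in> l2 X"
      using f A by (simp add: op_scale_def bounded_ops_l2 l2_scale(1))
    show "l2_norm X (op_scale X c A f) \<le> cmod c * K * l2_norm X f"
      using f l2_scale(2)[OF bounded_ops_l2[OF A f], of c] mult_left_mono[OF K[OF f], of "cmod c"]
      by (simp add: op_scale_def mult.assoc)
    show "op_scale X c A (\<lambda>v. b * f v) = (\<lambda>v. b * op_scale X c A f v)" for b
      using f A by (simp add: op_scale_def l2_scale(1) bounded_ops_scale mult.left_commute)
    show "op_scale X c A (\<lambda>v. f v + g v) = (\<lambda>v. op_scale X c A f v + op_scale X c A g v)"
      if "g \<in> l2 X" for g
      using f that A by (simp add: op_scale_def l2_add bounded_ops_add distrib_left)
  qed (auto simp: op_scale_def)
qed

lemma compose_bounded: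
  assumes A: "A \<in> bounded_ops X" and B: "B \<in> bounded_ops X"
  shows "compose (l2 X) A B \<in> bounded_ops X"
proof -
  obtain K where K: "0 \<le> K" "\<And>f. f \<in> l2 X \<Longrightarrow> l2_norm X (A f) \<le> K * l2_norm X f"
    using bounded_ops_bound[OF A] by blast
  obtain L where L: "\<And>f. f \<in> l2 X \<Longrightarrow> l2_norm X (B f) \<le> L * l2_norm X f"
    using bounded_ops_bound[OF B] by blast
  show ?thesis
  proof (rule bounded_opsI[where K = "K * L"])
    fix f assume f: "f \<in> l2 X"
    show "compose (l2 X) A B f \<in> l2 X"
      using f A B by (simp add: compose_def bounded_ops_l2)
    show "l2_norm X (compose (l2 X) A B f) \<le> K * L * l2_norm X f"
      using f K(2)[OF bounded_ops_l2[OF B f]] mult_left_mono[OF L[OF f] K(1)]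
      by (simp add: compose_def mult.assoc)
    show "compose (l2 X) A B (\<lambda>v. c * f v) = (\<lambda>v. c * compose (l2 X) A B f v)" for c
      using f A B by (simp add: compose_def l2_scale(1) bounded_ops_scale bounded_ops_l2)
    show "compose (l2 X) A B (\<lambda>v. f v + g v) = (\<lambda>v. compose (l2 X) A B f v + compose (l2 X) A B g v)"
      if "g \<in> l2 X" for g
      using f that A B by (simp add: compose_def l2_add bounded_ops_add bounded_ops_l2)
  qed auto
qed

lemma unital_subalgebra_bounded_ops: "unital_subalgebra X (bounded_ops X)"
  by (auto simp: unital_subalgebra_def op_id_bounded op_add_bounded op_scale_bounded compose_bounded)

lemma unital_subalgebra_CollectI:
  assumes "Q (op_id X)"
    and "\<And>A B. A \<in> bounded_ops X \<Longrightarrow> B \<in> bounded_ops X \<Longrightarrow> Q A \<Longrightarrow> Q B \<Longrightarrow> Q (op_add X A B)"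
    and "\<And>c A. A \<in> bounded_ops X \<Longrightarrow> Q A \<Longrightarrow> Q (op_scale X c A)"
    and "\<And>A B. A \<in> bounded_ops X \<Longrightarrow> B \<in> bounded_ops X \<Longrightarrow> Q A \<Longrightarrow> Q B \<Longrightarrow> Q (compose (l2 X) A B)"
  shows "unital_subalgebra X {A \<in> bounded_ops X. Q A}"
  using assms unfolding unital_subalgebra_def
  by (auto simp: op_id_bounded op_add_bounded op_scale_bounded compose_bounded)

section \<open>Weakly closed conditions and weak limits\<close>

lemma continuous_map_wot_inner:
  assumes "f \<in> l2 X" "g \<in> l2 X"
  shows "continuous_map (wot X) euclidean (\<lambda>B. l2_inner X (B f) g)"
proof -
  have "openin (wot X) {B \<in> bounded_ops X. l2_inner X (B f) g \<in> U}" if "open U" for U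
    unfolding wot_def using assms that by (intro topology_generated_by_Basis) blast
  then show ?thesis
    by (simp add: continuous_map topspace_wot)
qed

lemma continuous_map_wot_coord:
  assumes "f \<in> l2 X"
  shows "continuous_map (wot X) euclidean (\<lambda>B. B f x)"
proof (cases "x \<in> X")
  case True
  then show ?thesis
    using continuous_map_wot_inner[OF assms delta_l2[OF True]] by (simp add: l2_inner_delta)
next
  case False
  have "continuous_map (wot X) euclidean (\<lambda>B. 0 :: complex)"
    by simp
  then show ?thesis
    by (rule continuous_map_eq)
      (simp add: topspace_wot l2_eq_0[OF bounded_ops_l2 False] assms)
qed

text \<open>Two functions are allowed so that one lemma covers invariance of a coordinate space
  (\<open>g = f\<close>), commutation with \<open>A\<close> (the pair \<open>A f\<close>,
  \<open>f\<close>) and blindness to a cutoff.\<close>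

lemma closedin_wot_coord_eq:
  assumes "f \<in> l2 X" "g \<in> l2 X"
  shows "closedin (wot X) {B \<in> bounded_ops X. a * B f x = b * B g y}"
proof -
  have "continuous_map (wot X) euclidean (\<lambda>B. c * B f x)" if "f \<in> l2 X" for c f x
    using continuous_map_compose[OF continuous_map_wot_coord[OF that], of euclidean "(*) c" x]
    by (simp add: o_def continuous_intros)
  then show ?thesis
    unfolding topspace_wot[symmetric]
    using assms by (intro closedin_continuous_maps_eq[where Y = euclidean]) auto
qed

lemma closedin_wot_Ball:
  assumes "\<And>i. i \<in> I \<Longrightarrow> closedin (wot X) {B \<in> bounded_ops X. Q i B}"
  shows "closedin (wot X) {B \<in> bounded_ops X. \<forall>i\<in>I. Q i B}"
proof -
  \<comment> \<open>The whole space is inserted so that the intersection is over a nonempty family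
    even for empty \<open>I\<close>.\<close>
  have "{B \<in> bounded_ops X. \<forall>i\<in>I. Q i B} =
      \<Inter> (insert (topspace (wot X)) ((\<lambda>i. {B \<in> bounded_ops X. Q i B}) ` I))"
    by (auto simp: topspace_wot)
  also have "closedin (wot X) \<dots>"
    by (rule closedin_Inter) (use assms in auto)
  finally show ?thesis .
qed

text \<open>Eventual membership passes to finite intersections and arbitrary unions, so it suffices
  to test the generating sets.\<close>

lemma limitin_wot:
  assumes A: "A \<in> bounded_ops X" and \<sigma>: "\<And>n. \<sigma> n \<in> bounded_ops X"
    and lim: "\<And>f g. f \<in> l2 X \<Longrightarrow> g \<in> l2 X \<Longrightarrow>
      (\<lambda>n. l2_inner X (\<sigma> n f) g) \<longlonglongrightarrow> l2_inner X (A f) g"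
  shows "limitin (wot X) \<sigma> A sequentially"
  unfolding limitin_def
proof (intro conjI allI impI)
  show "A \<in> topspace (wot X)"
    using A by (simp add: topspace_wot)
  fix U
  assume U: "openin (wot X) U \<and> A \<in> U"
  then have "generate_topology_on
     {{A \<in> bounded_ops X. l2_inner X (A f) g \<in> U} | f g U. f \<in> l2 X \<and> g \<in> l2 X \<and> open U} U"
    unfolding wot_def by (intro openin_topology_generated_by) simp
  then have "A \<in> U \<longrightarrow> eventually (\<lambda>n. \<sigma> n \<in> U) sequentially"
  proof induction
    case (Int a b)
    then show ?case
      by (auto simp: eventually_conj_iff)
  next
    case (UN K)
    show ?case
    proof
      assume "A \<in> \<Union>K"
      then obtain k where k: "k \<in> K" "A \<in> k"
        by blast
      then have "eventually (\<lambda>n. \<sigma> n \<in> k) sequentially"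
        using UN by blast
      then show "eventually (\<lambda>n. \<sigma> n \<in> \<Union>K) sequentially"
        by eventually_elim (use k in blast)
    qed
  next
    case (Basis s)
    then obtain f g V where s: "s = {A \<in> bounded_ops X. l2_inner X (A f) g \<in> V}"
      and fg: "f \<in> l2 X" "g \<in> l2 X" "open V"
      by blast
    show ?case
    proof
      assume "A \<in> s"
      then have "eventually (\<lambda>n. l2_inner X (\<sigma> n f) g \<in> V) sequentially"
        using s fg by (intro topological_tendstoD[OF lim]) auto
      then show "eventually (\<lambda>n. \<sigma> n \<in> s) sequentially"
        using \<sigma> by (simp add: s)
    qed
  qed simp
  then show "eventually (\<lambda>n. \<sigma> n \<in> U) sequentially"
    using U by blast
qed

section \<open>The weakly closed algebra generated by one operator\<close>

lemma wot_algebra_least: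
  assumes "unital_subalgebra X W" "A \<in> W" "closedin (wot X) W"
  shows "wot_algebra X A \<subseteq> W"
  using assms by (auto simp: wot_algebra_def)

lemma wot_algebra_subset_bounded_ops:
  assumes "A \<in> bounded_ops X"
  shows "wot_algebra X A \<subseteq> bounded_ops X"
  by (rule wot_algebra_least[OF unital_subalgebra_bounded_ops assms])
    (metis closedin_topspace topspace_wot)

lemma self_in_wot_algebra: "A \<in> wot_algebra X A"
  by (auto simp: wot_algebra_def)

lemma unital_subalgebra_wot_algebra:
  assumes "A \<in> bounded_ops X"
  shows "unital_subalgebra X (wot_algebra X A)"
proof -
  have "wot_algebra X A \<subseteq> bounded_ops X"
    by (rule wot_algebra_subset_bounded_ops[OF assms])
  then show ?thesis
    unfolding unital_subalgebra_def
    by (simp add: wot_algebra_def unital_subalgebra_def)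
qed

lemma closedin_wot_algebra:
  assumes "A \<in> bounded_ops X"
  shows "closedin (wot X) (wot_algebra X A)"
proof -
  have "bounded_ops X \<in> {W. unital_subalgebra X W \<and> A \<in> W \<and> closedin (wot X) W}"
    using assms unital_subalgebra_bounded_ops closedin_topspace[of "wot X"]
    by (simp add: topspace_wot)
  then show ?thesis
    unfolding wot_algebra_def by (intro closedin_Inter) auto
qed

text \<open>For bounded \<open>B\<close>, preserving a coordinate space means satisfying coordinate
  equations on each \<open>B f\<close>, and these are weakly closed conditions on \<open>B\<close>.
  The operators that preserve the space thus form a weakly closed unital algebra.\<close>

lemma coord_space_in_Lat:
  assumes A: "A \<in> bounded_ops X" and inv: "A ` coord_space X C \<subseteq> coord_space X C"
  shows "coord_space X C \<in> Lat X (wot_algebra X A)"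
proof -
  let ?M = "coord_space X C"
  let ?W = "{B \<in> bounded_ops X. \<forall>f\<in>?M. \<forall>(a, x, b, y)\<in>C. a * B f x = b * B f y}"
  have sub: "?M \<subseteq> l2 X"
    by (auto simp: coord_space_def)
  have W: "?W = {B \<in> bounded_ops X. B ` ?M \<subseteq> ?M}"
    using sub by (fastforce simp: coord_space_def image_subset_iff intro: bounded_ops_l2)
  have M: "(\<lambda>v. f v + g v) \<in> ?M" "(\<lambda>v. c * f v) \<in> ?M" if "f \<in> ?M" "g \<in> ?M" for f g c
    using closed_subspace_coord_space[of X C] that by (auto simp: closed_subspace_def)
  have "closedin (wot X) ?W"
  proof (intro closedin_wot_Ball)
    fix f i
    assume "f \<in> ?M" "i \<in> C"
    then show "closedin (wot X) {B \<in> bounded_ops X. case i of (a, x, b, y) \<Rightarrow> a * B f x = b * B f y}"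
      using sub closedin_wot_coord_eq[of f X f] by (cases i) auto
  qed
  moreover have "unital_subalgebra X ?W"
    unfolding W
  proof (rule unital_subalgebra_CollectI)
    show "op_id X ` ?M \<subseteq> ?M"
      using sub by (auto simp: op_id_def)
    show "op_add X B D ` ?M \<subseteq> ?M" if "B ` ?M \<subseteq> ?M" "D ` ?M \<subseteq> ?M" for B D
    proof (rule image_subsetI)
      fix f assume f: "f \<in> ?M"
      then have "B f \<in> ?M" "D f \<in> ?M" "f \<in> l2 X"
        using that sub by blast+
      then show "op_add X B D f \<in> ?M"
        using M(1) by (simp add: op_add_def)
    qed
    show "op_scale X c B ` ?M \<subseteq> ?M" if "B ` ?M \<subseteq> ?M" for c B
    proof (rule image_subsetI)
      fix f assume f: "f \<in> ?M"
      then have "B f \<in> ?M" "f \<in> l2 X"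
        using that sub by blast+
      then show "op_scale X c B f \<in> ?M"
        using M(2) by (simp add: op_scale_def)
    qed
    show "compose (l2 X) B D ` ?M \<subseteq> ?M" if "B ` ?M \<subseteq> ?M" "D ` ?M \<subseteq> ?M" for B D
    proof (rule image_subsetI)
      fix f assume f: "f \<in> ?M"
      then have "B (D f) \<in> ?M" "f \<in> l2 X"
        using that sub by blast+
      then show "compose (l2 X) B D f \<in> ?M"
        by (simp add: compose_def)
    qed
  qed
  ultimately have "wot_algebra X A \<subseteq> ?W"
    using A inv by (intro wot_algebra_least) (auto simp: W)
  then show ?thesis
    unfolding W Lat_def using closed_subspace_coord_space by blast
qed

text \<open>Each coordinate of \<open>A f\<close> is a multiple of a single coordinate of
  \<open>f\<close>. Commutation with \<open>A\<close> therefore becomes a family of coordinate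
  equations, and its weak closedness needs no adjoint of \<open>A\<close>.\<close>

lemma wot_algebra_commute:
  assumes A: "A \<in> bounded_ops X"
    and coord: "\<And>v f. f \<in> l2 X \<Longrightarrow> A f v = \<alpha> v * f (\<pi> v)"
    and B: "B \<in> wot_algebra X A" and f: "f \<in> l2 X"
  shows "B (A f) = A (B f)"
proof -
  let ?W = "{B \<in> bounded_ops X. \<forall>f\<in>l2 X. \<forall>v\<in>UNIV. 1 * B (A f) v = \<alpha> v * B f (\<pi> v)}"
  have W: "?W = {B \<in> bounded_ops X. \<forall>f\<in>l2 X. B (A f) = A (B f)}"
    by (auto simp: coord bounded_ops_l2 fun_eq_iff)
  have A1: "A f \<in> l2 X" if "f \<in> l2 X" for f
    using bounded_ops_l2[OF A that] .
  have "closedin (wot X) ?W"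
    by (intro closedin_wot_Ball closedin_wot_coord_eq A1)
  moreover have "unital_subalgebra X ?W"
    unfolding W
  proof (rule unital_subalgebra_CollectI)
    show "\<forall>f\<in>l2 X. op_id X (A f) = A (op_id X f)"
      by (simp add: op_id_def A1)
    show "\<forall>f\<in>l2 X. op_add X B D (A f) = A (op_add X B D f)"
      if "B \<in> bounded_ops X" "D \<in> bounded_ops X"
        "\<forall>f\<in>l2 X. B (A f) = A (B f)" "\<forall>f\<in>l2 X. D (A f) = A (D f)" for B D
      using that by (simp add: op_add_def A1 bounded_ops_add[OF A] bounded_ops_l2)
    show "\<forall>f\<in>l2 X. op_scale X c B (A f) = A (op_scale X c B f)"
      if "B \<in> bounded_ops X" "\<forall>f\<in>l2 X. B (A f) = A (B f)" for c B
      using that by (simp add: op_scale_def A1 bounded_ops_scale[OF A] bounded_ops_l2)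
    show "\<forall>f\<in>l2 X. compose (l2 X) B D (A f) = A (compose (l2 X) B D f)"
      if "B \<in> bounded_ops X" "D \<in> bounded_ops X"
        "\<forall>f\<in>l2 X. B (A f) = A (B f)" "\<forall>f\<in>l2 X. D (A f) = A (D f)" for B D
      using that by (simp add: compose_def A1 bounded_ops_l2)
  qed
  moreover have "A \<in> ?W"
    unfolding W using A by simp
  ultimately have "wot_algebra X A \<subseteq> ?W"
    by (intro wot_algebra_least)
  then show ?thesis
    unfolding W using B f by blast
qed

section \<open>Compressions\<close>

lemma cutoff_add: "cutoff Q (\<lambda>v. f v + g v) = (\<lambda>v. cutoff Q f v + cutoff Q g v)"
  by (auto simp: cutoff_def)

lemma cutoff_scale: "cutoff Q (\<lambda>v. c * f v) = (\<lambda>v. c * cutoff Q f v)"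
  by (auto simp: cutoff_def)

lemma cutoff_id: "f \<in> l2 X \<Longrightarrow> cutoff (\<lambda>v. v \<in> X) f = f"
  by (rule ext) (simp add: cutoff_def l2_eq_0)

text \<open>Extension by zero makes every function on \<open>X\<close> a function on the larger set,
  so no embedding has to be written.\<close>

definition compression :: "'v set \<Rightarrow> 'v operator \<Rightarrow> 'v operator" where
  "compression X B = (\<lambda>f\<in>l2 X. cutoff (\<lambda>v. v \<in> X) (B f))"

lemma compression_bounded:
  assumes "X \<subseteq> Y" and B: "B \<in> bounded_ops Y"
  shows "compression X B \<in> bounded_ops X"
proof -
  obtain K where K: "\<And>f. f \<in> l2 Y \<Longrightarrow> l2_norm Y (B f) \<le> K * l2_norm Y f"
    using bounded_ops_bound[OF B] by blast
  note sup = l2_superset[OF assms(1)] and m = l2_cutoff_subset[OF assms(1)]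
  show ?thesis
  proof (rule bounded_opsI[where K = K])
    fix f assume f: "f \<in> l2 X"
    have Bf: "B f \<in> l2 Y"
      using bounded_ops_l2[OF B] sup(1)[OF f] .
    show "compression X B f \<in> l2 X"
      using f m(1)[OF Bf] by (simp add: compression_def)
    show "l2_norm X (compression X B f) \<le> K * l2_norm X f"
      using f m(2)[OF Bf] K[OF sup(1)[OF f]] by (simp add: compression_def sup(2)[OF f])
    show "compression X B (\<lambda>v. c * f v) = (\<lambda>v. c * compression X B f v)" for c
      using f by (auto simp: compression_def l2_scale(1) bounded_ops_scale[OF B] sup(1) cutoff_def)
    show "compression X B (\<lambda>v. f v + g v) = (\<lambda>v. compression X B f v + compression X B g v)"
      if "g \<in> l2 X" for g
      using f that by (auto simp: compression_def l2_add bounded_ops_add[OF B] sup(1) cutoff_def)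
  qed (auto simp: compression_def)
qed

text \<open>A function \<open>g\<close> supported in \<open>X\<close> does not see the coordinates
  that the cutoff removes, so matrix coefficients of the compression are matrix coefficients of the
  operator.\<close>

lemma continuous_map_compression:
  assumes "X \<subseteq> Y"
  shows "continuous_map (wot Y) (wot X) (compression X)"
  unfolding wot_def[of X]
proof (rule continuous_on_generated_topo)
  let ?S = "{{A \<in> bounded_ops X. l2_inner X (A f) g \<in> U} | f g U. f \<in> l2 X \<and> g \<in> l2 X \<and> open U}"
  show "compression X ` topspace (wot Y) \<subseteq> \<Union>?S"
  proof -
    have "\<Union>?S = bounded_ops X"
      using topspace_wot[of X] unfolding wot_def topology_generated_by_topspace .
    then show ?thesis
      using compression_bounded[OF assms] by (simp only: topspace_wot) blast
  qed
  fix S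
  assume "S \<in> ?S"
  then obtain f g U where S: "S = {A \<in> bounded_ops X. l2_inner X (A f) g \<in> U}"
    and fg: "f \<in> l2 X" "g \<in> l2 X" "open U"
    by blast
  have inner: "l2_inner X (compression X B f) g = l2_inner Y (B f) g" for B
    unfolding l2_inner_superset[OF assms fg(2)]
    using fg(1) by (auto simp: compression_def cutoff_def l2_inner_def intro!: infsum_cong)
  have "compression X -` S \<inter> topspace (wot Y) = {B \<in> topspace (wot Y). l2_inner Y (B f) g \<in> U}"
    using compression_bounded[OF assms] by (auto simp: S inner topspace_wot)
  also have "openin (wot Y) \<dots>"
    using fg by (intro openin_continuous_map_preimage[OF continuous_map_wot_inner])
      (auto intro: l2_superset(1)[OF assms])
  finally show "openin (wot Y) (compression X -` S \<inter> topspace (wot Y))" .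
qed

text \<open>Compression is a weakly continuous homomorphism on the algebra generated by \<open>A\<close>. Pulling back the
  algebra of \<open>A'\<close> along it avoids showing that norm closed subspaces are weakly closed.\<close>

lemma compression_in_wot_algebra:
  assumes sub: "X \<subseteq> Y" and A: "A \<in> bounded_ops Y" and A': "A' \<in> bounded_ops X"
    and int: "\<And>f. f \<in> l2 Y \<Longrightarrow> cutoff (\<lambda>v. v \<in> X) (A f) = A' (cutoff (\<lambda>v. v \<in> X) f)"
    and B: "B \<in> wot_algebra Y A"
  shows "compression X B \<in> wot_algebra X A'"
    and "f \<in> l2 Y \<Longrightarrow> cutoff (\<lambda>v. v \<in> X) (B f) = compression X B (cutoff (\<lambda>v. v \<in> X) f)"
proof -
  let ?c = "cutoff (\<lambda>v. v \<in> X)"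
  note m = l2_cutoff_subset(1)[OF sub] and sup = l2_superset(1)[OF sub]
  have cY: "?c f \<in> l2 Y" if "f \<in> l2 Y" for f
    using sup m that by blast
  have W1: "unital_subalgebra X (wot_algebra X A')"
    by (rule unital_subalgebra_wot_algebra[OF A'])
  have cX: "?c f = f" if "f \<in> l2 X" for f
    by (rule cutoff_id[OF that])
  have idem: "?c (?c f) = ?c f" for f
    by (auto simp: cutoff_def)
  \<comment> \<open>\<open>?Q B\<close> says that \<open>B\<close> preserves the functions vanishing
    on \<open>X\<close>. It is carried along because compression is multiplicative only under this
    condition; it also yields the second conclusion.\<close>
  let ?Q = "\<lambda>B. \<forall>f\<in>l2 Y. ?c (B (?c f)) = ?c (B f)"
  let ?W = "{B \<in> bounded_ops Y. ?Q B \<and> compression X B \<in> wot_algebra X A'}"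
  have WQ: "{B \<in> bounded_ops Y. ?Q B} =
      {B \<in> bounded_ops Y. \<forall>f\<in>l2 Y. \<forall>v\<in>X. 1 * B (?c f) v = 1 * B f v}"
    by (intro Collect_cong conj_cong ball_cong refl) (auto simp: cutoff_def fun_eq_iff)
  have "closedin (wot Y) {B \<in> bounded_ops Y. ?Q B}"
    unfolding WQ by (intro closedin_wot_Ball closedin_wot_coord_eq cY)
  moreover have "closedin (wot Y) {B \<in> topspace (wot Y). compression X B \<in> wot_algebra X A'}"
    by (rule closedin_continuous_map_preimage[OF continuous_map_compression[OF sub]])
      (rule closedin_wot_algebra[OF A'])
  moreover have "?W = {B \<in> bounded_ops Y. ?Q B} \<inter>
      {B \<in> topspace (wot Y). compression X B \<in> wot_algebra X A'}"
    unfolding topspace_wot by blast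
  ultimately have "closedin (wot Y) ?W"
    by (simp only: closedin_Int)
  moreover have "unital_subalgebra Y ?W"
  proof (rule unital_subalgebra_CollectI)
    have "compression X (op_id Y) = op_id X"
      using sup by (auto simp: compression_def op_id_def cX intro!: restrict_ext)
    then show "?Q (op_id Y) \<and> compression X (op_id Y) \<in> wot_algebra X A'"
      using W1 by (simp add: op_id_def cY idem unital_subalgebra_def)
    fix B D c
    assume B: "B \<in> bounded_ops Y" "?Q B \<and> compression X B \<in> wot_algebra X A'"
    have "compression X (op_scale Y c B) = op_scale X c (compression X B)"
      unfolding compression_def op_scale_def
      by (rule restrict_ext) (simp add: sup cutoff_scale)
    moreover have "?Q (op_scale Y c B)"
      using B by (simp add: op_scale_def cY cutoff_scale)
    ultimately show "?Q (op_scale Y c B) \<and> compression X (op_scale Y c B) \<in> wot_algebra X A'"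
      using W1 B by (simp add: unital_subalgebra_def)
    assume D: "D \<in> bounded_ops Y" "?Q D \<and> compression X D \<in> wot_algebra X A'"
    have "compression X (op_add Y B D) = op_add X (compression X B) (compression X D)"
      unfolding compression_def op_add_def
      by (rule restrict_ext) (simp add: sup cutoff_add)
    moreover have "?Q (op_add Y B D)"
      using B D by (simp add: op_add_def cY cutoff_add)
    ultimately show "?Q (op_add Y B D) \<and> compression X (op_add Y B D) \<in> wot_algebra X A'"
      using W1 B D by (simp add: unital_subalgebra_def)
    have BD: "?c (B (?c (D f))) = ?c (B (D f))" if "f \<in> l2 Y" for f
      using B(2) bounded_ops_l2[OF D(1) that] by blast
    have "compression X (compose (l2 Y) B D) = compose (l2 X) (compression X B) (compression X D)"
      unfolding compression_def compose_def
      by (rule restrict_ext) (simp add: sup BD m[OF bounded_ops_l2[OF D(1)]])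
    moreover have "?c (B (D (?c f))) = ?c (B (D f))" if "f \<in> l2 Y" for f
      using BD[OF that] BD[OF cY[OF that]] D(2) that by simp
    ultimately show "?Q (compose (l2 Y) B D) \<and> compression X (compose (l2 Y) B D) \<in> wot_algebra X A'"
      using W1 B D by (simp add: compose_def cY unital_subalgebra_def)
  qed
  moreover have "A \<in> ?W"
  proof -
    have "compression X A = A'"
    proof (rule extensionalityI)
      show "compression X A f = A' f" if "f \<in> l2 X" for f
        using int[OF sup[OF that]] that by (simp add: compression_def cX)
    qed (use bounded_ops_ext[OF A'] in \<open>auto simp: compression_def\<close>)
    then show ?thesis
      using A int cY by (simp add: self_in_wot_algebra idem)
  qed
  ultimately have "B \<in> ?W"
    using wot_algebra_least[of Y ?W A] B by blast
  then show "compression X B \<in> wot_algebra X A'"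
    and "f \<in> l2 Y \<Longrightarrow> ?c (B f) = compression X B (?c f)"
    using m by (simp_all add: compression_def)
qed

text \<open>An invariant \<open>N\<close> on \<open>X\<close> pulls back to \<open>?M\<close>, the
  functions on \<open>Y\<close> whose cutoff lies in \<open>N\<close>; \<open>?M\<close> is
  invariant because the cutoff intertwines every \<open>D\<close> with its compression. Elements of
  \<open>N\<close>, extended by zero, lie in \<open>?M\<close>, and cutting off their image under
  \<open>B\<close> gives the compression.\<close>

lemma compression_in_Alg_Lat:
  assumes sub: "X \<subseteq> Y" and A: "A \<in> bounded_ops Y" and A': "A' \<in> bounded_ops X"
    and int: "\<And>f. f \<in> l2 Y \<Longrightarrow> cutoff (\<lambda>v. v \<in> X) (A f) = A' (cutoff (\<lambda>v. v \<in> X) f)"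
    and B: "B \<in> Alg Y (Lat Y (wot_algebra Y A))"
  shows "compression X B \<in> Alg X (Lat X (wot_algebra X A'))"
proof -
  let ?c = "cutoff (\<lambda>v. v \<in> X)"
  have BY: "B \<in> bounded_ops Y"
    using B by (simp add: Alg_def)
  have "compression X B ` N \<subseteq> N" if N: "N \<in> Lat X (wot_algebra X A')" for N
  proof -
    have clN: "closed_subspace X N" and inv: "\<And>D. D \<in> wot_algebra X A' \<Longrightarrow> D ` N \<subseteq> N"
      using N by (auto simp: Lat_def)
    have NX: "N \<subseteq> l2 X"
      using closedin_subset[of _ N] clN Metric_space.topspace_mtopology[OF Metric_space_l2, of X]
      unfolding closed_subspace_def by metis
    let ?M = "{f \<in> l2 Y. ?c f \<in> N}"
    have "D ` ?M \<subseteq> ?M" if D: "D \<in> wot_algebra Y A" for D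
      using inv[OF compression_in_wot_algebra(1)[OF sub A A' int D]]
        compression_in_wot_algebra(2)[OF sub A A' int D]
        bounded_ops_l2 wot_algebra_subset_bounded_ops[OF A] D
      by (fastforce simp: image_subset_iff)
    then have "?M \<in> Lat Y (wot_algebra Y A)"
      using closed_subspace_cutoff[OF sub clN] by (auto simp: Lat_def)
    then have BM: "B ` ?M \<subseteq> ?M"
      using B by (auto simp: Alg_def)
    show ?thesis
    proof
      fix g assume "g \<in> compression X B ` N"
      then obtain f where f: "f \<in> N" "g = compression X B f"
        by blast
      have "?c f = f"
        using f NX by (intro cutoff_id) blast
      then have "f \<in> ?M"
        using f NX l2_superset(1)[OF sub] by auto
      then show "g \<in> N"
        using BM f NX by (auto simp: compression_def)
    qed
  qed
  then show ?thesis
    using compression_bounded[OF sub BY] by (simp add: Alg_def)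
qed

section \<open>Weighted trees\<close>

text \<open>The depth function replaces reachability of the root and carries the inductions. A path
  is only a subset \<open>X\<close> closed under \<open>p\<close>, so both shifts share all
  data.\<close>

locale weighted_tree =
  fixes V :: "'v set" and r :: 'v and p :: "'v \<Rightarrow> 'v" and d :: "'v \<Rightarrow> nat" and lam :: "'v \<Rightarrow> real"
  assumes root_in: "r \<in> V"
    and parent_in: "v \<in> V \<Longrightarrow> v \<noteq> r \<Longrightarrow> p v \<in> V"
    and depth_root: "d r = 0"
    and depth_Suc: "v \<in> V \<Longrightarrow> v \<noteq> r \<Longrightarrow> d v = Suc (d (p v))"
    and leafless: "v \<in> V \<Longrightarrow> \<exists>w\<in>V. w \<noteq> r \<and> p w = v"
    and lam_pos: "v \<in> V \<Longrightarrow> v \<noteq> r \<Longrightarrow> 0 < lam v"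
begin

text \<open>Total on all functions, so that iterates can be computed coordinatewise without
  membership in \<open>l2\<close>; \<open>shift_op\<close> is the operator proper.\<close>

definition shift :: "'v set \<Rightarrow> 'v operator" where
  "shift X f = (\<lambda>v. if v \<in> X - {r} then of_real (lam v) * f (p v) else 0)"

definition shift_op :: "'v set \<Rightarrow> 'v operator" where
  "shift_op X = restrict (shift X) (l2 X)"

abbreviation L :: "'v operator" where "L \<equiv> shift V"

lemma depth_0_iff: "v \<in> V \<Longrightarrow> d v = 0 \<longleftrightarrow> v = r"
  using depth_root depth_Suc by fastforce

lemma L_simps [simp]:
  "L f r = 0" "v \<notin> V \<Longrightarrow> L f v = 0"
  "v \<in> V \<Longrightarrow> v \<noteq> r \<Longrightarrow> L f v = of_real (lam v) * f (p v)"
  by (auto simp: shift_def)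

lemma L_pow_shallow: "w \<in> V \<Longrightarrow> d w < k \<Longrightarrow> (L ^^ k) f w = 0"
proof (induction k arbitrary: w)
  case (Suc k)
  then show ?case
    by (cases "w = r") (auto simp: parent_in depth_Suc)
qed simp

lemma L_pow_linear:
  "(L ^^ k) (\<lambda>v. f v + g v) = (\<lambda>v. (L ^^ k) f v + (L ^^ k) g v)"
  "(L ^^ k) (\<lambda>v. c * f v) = (\<lambda>v. c * (L ^^ k) f v)"
  by (induction k) (auto simp: shift_def distrib_left)

text \<open>The product of the weights from \<open>x\<close> down to \<open>w\<close>, or \<open>0\<close> if \<open>w\<close> does not descend from \<open>x\<close>; if
  \<open>d w < d x\<close>, the difference is truncated to \<open>0\<close> and the value is \<open>delta x w = 0\<close>.\<close>

definition orbit :: "'v \<Rightarrow> 'v \<Rightarrow> complex" where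
  "orbit x w = (L ^^ (d w - d x)) (delta x) w"

lemma orbit_shallow: "d w \<le> d x \<Longrightarrow> orbit x w = delta x w"
  by (simp add: orbit_def)

lemma orbit_step:
  assumes "w \<in> V" "d x < d w"
  shows "orbit x w = of_real (lam w) * orbit x (p w)"
proof -
  have w: "w \<noteq> r"
    using assms depth_root by auto
  have "d w - d x = Suc (d (p w) - d x)"
    using assms depth_Suc[OF assms(1) w] by simp
  then show ?thesis
    using assms w by (simp add: orbit_def)
qed

text \<open>The iterates of \<open>delta x\<close> live on distinct levels, and
  \<open>orbit x\<close> is their superposition.\<close>

lemma L_pow_delta:
  assumes "w \<in> V"
  shows "(L ^^ k) (delta x) w = (if d w = d x + k then orbit x w else 0)"
  using assms
proof (induction k arbitrary: w)
  case 0
  then show ?case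
    by (auto simp: orbit_def delta_def)
next
  case (Suc k)
  then show ?case
    by (cases "w = r") (auto simp: depth_root parent_in depth_Suc orbit_step)
qed

text \<open>Leaflessness continues a chain of descendants to any level, and the weights along it are
  nonzero.\<close>

lemma orbit_nonzero_level:
  assumes "x \<in> V" "d x \<le> m"
  shows "\<exists>w\<in>V. d w = m \<and> orbit x w \<noteq> 0"
  using assms(2)
proof (induction m rule: dec_induct)
  case base
  then show ?case
    using assms by (intro bexI[of _ x]) (auto simp: orbit_shallow delta_def)
next
  case (step m)
  then obtain w where w: "w \<in> V" "d w = m" "orbit x w \<noteq> 0"
    by blast
  obtain u where u: "u \<in> V" "u \<noteq> r" "p u = w"
    using leafless w(1) by blast
  show ?case
    using w u step lam_pos[OF u(1,2)] by (intro bexI[of _ u]) (auto simp: depth_Suc orbit_step)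
qed

text \<open>Parents are unique, so a common descendant would have a common descendant as parent, up
  to the level where \<open>x\<close> and \<open>y\<close> differ.\<close>

lemma orbit_disjoint:
  assumes "d x = d y" "x \<noteq> y" "w \<in> V"
  shows "orbit x w = 0 \<or> orbit y w = 0"
  using assms(3)
proof (induction "d w" arbitrary: w)
  case 0
  then show ?case
    using assms by (auto simp: orbit_shallow delta_def)
next
  case (Suc n)
  show ?case
  proof (cases "d x < d w")
    case True
    have "w \<noteq> r"
      using True depth_root by auto
    then have "p w \<in> V" "n = d (p w)"
      using Suc depth_Suc parent_in by auto
    then show ?thesis
      using Suc.hyps(1)[of "p w"] True assms(1) Suc.prems by (auto simp: orbit_step)
  next
    case False
    then show ?thesis
      using assms by (auto simp: orbit_shallow delta_def)
  qed
qed

end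

locale bounded_weighted_tree = weighted_tree +
  assumes S_bounded: "shift_op V \<in> bounded_ops V"
begin

abbreviation S :: "'a operator" where "S \<equiv> shift_op V"

lemma S_apply: "f \<in> l2 V \<Longrightarrow> S f = L f"
  by (simp add: shift_op_def)

lemma L_l2: "f \<in> l2 V \<Longrightarrow> L f \<in> l2 V"
  using bounded_ops_l2[OF S_bounded] S_apply by metis

lemma L_pow_l2: "f \<in> l2 V \<Longrightarrow> (L ^^ k) f \<in> l2 V"
  by (induction k) (auto simp: L_l2)

section \<open>Operators in Alg Lat\<close>

text \<open>The functions that are a multiple of \<open>h\<close> on each level form an invariant subspace.\<close>

lemma Alg_Lat_graded:
  assumes A: "A \<in> Alg V (Lat V (wot_algebra V S))"
    and low: "\<And>w. w \<in> V \<Longrightarrow> d w < n \<Longrightarrow> h w = 0"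
    and step: "\<And>w. w \<in> V \<Longrightarrow> n < d w \<Longrightarrow> h w = of_real (lam w) * h (p w)"
    and g: "g \<in> l2 V" "\<And>w. w \<in> V \<Longrightarrow> g w = (if d w = n then h w else 0)"
  shows "\<exists>c. \<forall>w\<in>V. A g w = c (d w) * h w"
proof -
  \<comment> \<open>The second family states proportionality to \<open>h\<close> on each level. It
    is void on a level where \<open>h\<close> vanishes identically, and there the first family
    forces \<open>f\<close> to vanish.\<close>
  define C where "C = (\<lambda>w. (1, w, 0, w)) ` {w \<in> V. h w = 0} \<union>
    (\<lambda>(w, w'). (h w', w, h w, w')) ` {(w, w'). w \<in> V \<and> w' \<in> V \<and> d w = d w'}"
  have mem: "f \<in> coord_space V C \<longleftrightarrow> f \<in> l2 V \<and> (\<forall>w\<in>V. h w = 0 \<longrightarrow> f w = 0) \<and>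
      (\<forall>w\<in>V. \<forall>w'\<in>V. d w = d w' \<longrightarrow> h w' * f w = h w * f w')" for f
    by (auto simp: coord_space_def C_def ball_Un)
  have "L f \<in> coord_space V C" if f: "f \<in> coord_space V C" for f
  proof -
    have f0: "f \<in> l2 V" "\<And>w. w \<in> V \<Longrightarrow> h w = 0 \<Longrightarrow> f w = 0"
      and f1: "\<And>w w'. w \<in> V \<Longrightarrow> w' \<in> V \<Longrightarrow> d w = d w' \<Longrightarrow> h w' * f w = h w * f w'"
      using f unfolding mem by auto
    \<comment> \<open>Level \<open>n\<close> is treated apart because the recursion for
      \<open>h\<close> starts only above it; here \<open>f\<close> vanishes at the parents, whose
      level is below \<open>n\<close>.\<close>
    have L0: "L f w = 0" if "w \<in> V" "d w \<le> n" for w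
      using that f0(2)[of "p w"] low[of "p w"] parent_in depth_Suc by (cases "w = r") auto
    have "L f w = 0" if "w \<in> V" "h w = 0" for w
    proof (cases "n < d w")
      case True
      then have w: "w \<noteq> r"
        using depth_root by auto
      then have "h (p w) = 0"
        using step[OF that(1) True] that lam_pos by force
      then show ?thesis
        using w that f0(2)[of "p w"] parent_in by simp
    qed (use L0 that in auto)
    moreover have "h w' * L f w = h w * L f w'" if w: "w \<in> V" "w' \<in> V" "d w = d w'" for w w'
    proof (cases "n < d w")
      case True
      then have "w \<noteq> r" "w' \<noteq> r"
        using depth_root w by auto
      then show ?thesis
        using f1[of "p w" "p w'"] w True step[of w] step[of w'] depth_Suc parent_in by simp
    qed (use L0 w in auto)
    ultimately show ?thesis
      using L_l2[OF f0(1)] by (simp add: mem)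
  qed
  then have "coord_space V C \<in> Lat V (wot_algebra V S)"
    by (intro coord_space_in_Lat S_bounded) (auto simp: mem S_apply)
  moreover have "g \<in> coord_space V C"
    using g by (auto simp: mem)
  ultimately have Ag: "A g \<in> coord_space V C"
    using A by (auto simp: Alg_def)
  \<comment> \<open>A reference vertex per level, whose quotient is the factor. If \<open>h\<close>
    vanishes on the whole level the choice is arbitrary, but then \<open>A g\<close> vanishes there
    too.\<close>
  define u where "u m = (SOME w. w \<in> V \<and> d w = m \<and> h w \<noteq> 0)" for m
  have "A g w = A g (u (d w)) / h (u (d w)) * h w" if w: "w \<in> V" for w
  proof (cases "h w = 0")
    case True
    then show ?thesis
      using Ag w by (simp add: mem)
  next
    case False
    then have "\<exists>w'. w' \<in> V \<and> d w' = d w \<and> h w' \<noteq> 0"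
      using w by blast
    then have "u (d w) \<in> V \<and> d (u (d w)) = d w \<and> h (u (d w)) \<noteq> 0"
      unfolding u_def by (rule someI_ex)
    moreover from this have "h (u (d w)) * A g w = h w * A g (u (d w))"
      using Ag w unfolding mem by metis
    ultimately show ?thesis
      by (simp add: field_simps)
  qed
  then show ?thesis
    by (intro exI[of _ "\<lambda>m. A g (u m) / h (u m)"]) blast
qed

lemma Alg_Lat_orbit:
  assumes A: "A \<in> Alg V (Lat V (wot_algebra V S))"
  obtains a where "\<And>x w. x \<in> V \<Longrightarrow> w \<in> V \<Longrightarrow> A (delta x) w = a x (d w) * orbit x w"
    and "\<And>x y m. x \<in> V \<Longrightarrow> y \<in> V \<Longrightarrow> d x = d y \<Longrightarrow> d x \<le> m \<Longrightarrow> a x m = a y m"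
proof -
  have low: "orbit x w = 0" if "d w < d x" for x w
    using that by (auto simp: orbit_shallow delta_def)
  have lev: "delta x w = (if d w = d x then orbit x w else 0)" for x w
    by (auto simp: orbit_shallow delta_def)
  have "\<exists>c. \<forall>w\<in>V. A (delta x) w = c (d w) * orbit x w" if "x \<in> V" for x
    by (rule Alg_Lat_graded[OF A, where n = "d x"]) (use that low lev orbit_step delta_l2 in auto)
  then obtain a where a: "A (delta x) w = a x (d w) * orbit x w" if "x \<in> V" "w \<in> V" for x w
    by metis
  have "a x m = a y m" if xy: "x \<in> V" "y \<in> V" "d x = d y" "d x \<le> m" for x y m
  proof (cases "x = y")
    case False
    have "\<exists>c. \<forall>w\<in>V. A (\<lambda>v. delta x v + delta y v) w = c (d w) * (orbit x w + orbit y w)"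
    proof (rule Alg_Lat_graded[OF A, where n = "d x"])
      show "(\<lambda>v. delta x v + delta y v) \<in> l2 V"
        using xy by (intro l2_add delta_l2)
    qed (use xy low orbit_step in \<open>auto simp: distrib_left lev\<close>)
    then obtain c where c: "A (\<lambda>v. delta x v + delta y v) w = c (d w) * (orbit x w + orbit y w)"
      if "w \<in> V" for w
      by blast
    have "A \<in> bounded_ops V"
      using A by (simp add: Alg_def)
    then have sum: "A (\<lambda>v. delta x v + delta y v) w = a x (d w) * orbit x w + a y (d w) * orbit y w"
      if "w \<in> V" for w
      using a xy that by (simp add: bounded_ops_add delta_l2)
    \<comment> \<open>At \<open>w\<close> only the orbit of \<open>x\<close> survives and at
      \<open>w'\<close> only that of \<open>y\<close>, so both factors equal
      \<open>c m\<close>.\<close>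
    obtain w where w: "w \<in> V" "d w = m" "orbit x w \<noteq> 0"
      using orbit_nonzero_level xy by blast
    obtain w' where w': "w' \<in> V" "d w' = m" "orbit y w' \<noteq> 0"
      using orbit_nonzero_level[of y m] xy by auto
    have "orbit y w = 0" "orbit x w' = 0"
      using orbit_disjoint[OF xy(3) False] w w' by blast+
    then show ?thesis
      using c[OF w(1)] sum[OF w(1)] c[OF w'(1)] sum[OF w'(1)] w w' by simp
  qed simp
  with a show ?thesis
    using that by blast
qed

text \<open>Functions vanishing on a parent-closed set \<open>F\<close> form an invariant subspace,
  because the shift reads the value at the parent. Hence \<open>A f w\<close> depends only on
  \<open>f\<close> on \<open>F\<close>, and the expansion of \<open>f\<close> is finite.\<close>

lemma Alg_Lat_ancestors:
  assumes A: "A \<in> Alg V (Lat V (wot_algebra V S))"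
    and w: "w \<in> V" and F: "finite F" "F \<subseteq> V" "w \<in> F" "\<And>v. v \<in> F \<Longrightarrow> v \<noteq> r \<Longrightarrow> p v \<in> F"
    and f: "f \<in> l2 V"
  shows "A f w = (\<Sum>u\<in>F. f u * A (delta u) w)"
proof -
  have AV: "A \<in> bounded_ops V"
    using A by (simp add: Alg_def)
  have Fin: "A (cutoff (\<lambda>v. v \<in> G) f) w = (\<Sum>u\<in>G. f u * A (delta u) w)" if "finite G" "G \<subseteq> V" for G
    using that
  proof (induction G rule: finite_induct)
    case empty
    have "A (\<lambda>v. 0 * f v) w = 0"
      using bounded_ops_scale[OF AV f, of 0] by simp
    then show ?case
      by (simp add: cutoff_def)
  next
    case (insert u G)
    have eq: "cutoff (\<lambda>v. v \<in> insert u G) f = (\<lambda>v. cutoff (\<lambda>v. v \<in> G) f v + f u * delta u v)"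
      using insert.hyps by (auto simp: cutoff_def delta_def)
    show ?case
      unfolding eq using insert
      by (simp add: bounded_ops_add[OF AV] bounded_ops_scale[OF AV] l2_cutoff(1) f l2_scale(1) delta_l2)
  qed
  let ?C = "{(1, v, 0, v) |v. v \<in> F}"
  have mem: "g \<in> coord_space V ?C \<longleftrightarrow> g \<in> l2 V \<and> (\<forall>v\<in>F. g v = 0)" for g :: "'a \<Rightarrow> complex"
    unfolding coord_space_def by fastforce
  have "L g v = 0" if "\<forall>v\<in>F. g v = 0" "v \<in> F" for g v
    using that F by (simp add: shift_def)
  then have "coord_space V ?C \<in> Lat V (wot_algebra V S)"
    by (intro coord_space_in_Lat S_bounded) (auto simp: mem S_apply L_l2)
  moreover have "cutoff (\<lambda>v. v \<notin> F) f \<in> coord_space V ?C"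
    using f by (simp add: mem l2_cutoff(1)) (simp add: cutoff_def)
  ultimately have "A (cutoff (\<lambda>v. v \<notin> F) f) \<in> coord_space V ?C"
    using A by (auto simp: Alg_def)
  then have 0: "A (cutoff (\<lambda>v. v \<notin> F) f) w = 0"
    using F by (simp add: mem)
  have "f = (\<lambda>v. cutoff (\<lambda>v. v \<in> F) f v + cutoff (\<lambda>v. v \<notin> F) f v)"
    by (auto simp: cutoff_def)
  then have "A f w = A (cutoff (\<lambda>v. v \<in> F) f) w + A (cutoff (\<lambda>v. v \<notin> F) f) w"
    using bounded_ops_add[OF AV l2_cutoff(1)[OF f] l2_cutoff(1)[OF f]] by metis
  then show ?thesis
    using Fin[OF F(1,2)] 0 by simp
qed

lemma finite_ancestors:
  assumes "w \<in> V"
  obtains F where "finite F" "F \<subseteq> V" "w \<in> F" "\<And>v. v \<in> F \<Longrightarrow> v \<noteq> r \<Longrightarrow> p v \<in> F"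
proof -
  have "\<exists>F. finite F \<and> F \<subseteq> V \<and> w \<in> F \<and> (\<forall>v\<in>F. v \<noteq> r \<longrightarrow> p v \<in> F)"
    using assms
  proof (induction "d w" arbitrary: w)
    case 0
    then have "w = r"
      using depth_0_iff by simp
    then show ?case
      using root_in by (intro exI[of _ "{r}"]) simp
  next
    case (Suc n)
    then have w: "w \<noteq> r"
      using depth_root by auto
    then obtain F where "finite F" "F \<subseteq> V" "p w \<in> F" "\<forall>v\<in>F. v \<noteq> r \<longrightarrow> p v \<in> F"
      using Suc.hyps(1)[of "p w"] Suc.hyps(2) Suc.prems depth_Suc parent_in by auto
    then show ?case
      using Suc.prems by (intro exI[of _ "insert w F"]) auto
  qed
  then show ?thesis
    using that by blast
qed

lemma L_pow_vanish:
  assumes F: "F \<subseteq> V" "\<And>v. v \<in> F \<Longrightarrow> v \<noteq> r \<Longrightarrow> p v \<in> F"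
    and "w \<in> F" "\<And>v. v \<in> F \<Longrightarrow> g v = 0"
  shows "(L ^^ k) g w = 0"
  using assms(3)
proof (induction k arbitrary: w)
  case 0
  then show ?case
    using assms by simp
next
  case (Suc k)
  then show ?case
    using F by (simp add: shift_def)
qed

text \<open>The same finite expansion as for \<open>A\<close>, so that an identity between the two
  has to be checked only on the functions \<open>delta u\<close>.\<close>

lemma L_pow_ancestors:
  assumes F: "finite F" "F \<subseteq> V" "w \<in> F" "\<And>v. v \<in> F \<Longrightarrow> v \<noteq> r \<Longrightarrow> p v \<in> F"
  shows "(L ^^ k) f w = (\<Sum>u\<in>F. f u * (L ^^ k) (delta u) w)"
proof -
  have Fin: "(L ^^ k) (cutoff (\<lambda>v. v \<in> G) f) w = (\<Sum>u\<in>G. f u * (L ^^ k) (delta u) w)" if "finite G" for G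
    using that
  proof (induction G rule: finite_induct)
    case empty
    have "(L ^^ k) (\<lambda>v. 0 * f v) w = 0"
      by (simp only: L_pow_linear) simp
    then show ?case
      by (simp add: cutoff_def)
  next
    case (insert u G)
    have eq: "cutoff (\<lambda>v. v \<in> insert u G) f = (\<lambda>v. cutoff (\<lambda>v. v \<in> G) f v + f u * delta u v)"
      using insert.hyps by (auto simp: cutoff_def delta_def)
    show ?case
      unfolding eq L_pow_linear using insert by simp
  qed
  have "(L ^^ k) (cutoff (\<lambda>v. v \<notin> F) f) w = 0"
    using F by (intro L_pow_vanish[of F]) (auto simp: cutoff_def)
  moreover have "f = (\<lambda>v. cutoff (\<lambda>v. v \<in> F) f v + cutoff (\<lambda>v. v \<notin> F) f v)"
    by (auto simp: cutoff_def)
  then have "(L ^^ k) f w = (L ^^ k) (cutoff (\<lambda>v. v \<in> F) f) w + (L ^^ k) (cutoff (\<lambda>v. v \<notin> F) f) w"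
    using L_pow_linear(1) by metis
  ultimately show ?thesis
    using Fin[OF F(1)] by simp
qed

text \<open>The sum stops at \<open>d w\<close> because higher iterates vanish at \<open>w\<close>.
  The power series is thus read coordinatewise, without any claim of convergence.\<close>

lemma Alg_Lat_multiplier:
  assumes A: "A \<in> Alg V (Lat V (wot_algebra V S))"
    and sub: "X \<subseteq> V" and rX: "r \<in> X" and parX: "\<And>v. v \<in> X \<Longrightarrow> v \<noteq> r \<Longrightarrow> p v \<in> X"
    and childX: "\<And>v. v \<in> X \<Longrightarrow> \<exists>!w. w \<in> X \<and> w \<noteq> r \<and> p w = v"
    and bX: "shift_op X \<in> bounded_ops X"
    and refl: "Alg X (Lat X (wot_algebra X (shift_op X))) \<subseteq> wot_algebra X (shift_op X)"
  shows "\<exists>\<phi>. \<forall>f\<in>l2 V. \<forall>w\<in>V. A f w = (\<Sum>k\<le>d w. \<phi> k * (L ^^ k) f w)"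
proof -
  let ?c = "cutoff (\<lambda>v. v \<in> X)"
  obtain a where a: "\<And>x w. x \<in> V \<Longrightarrow> w \<in> V \<Longrightarrow> A (delta x) w = a x (d w) * orbit x w"
    and level: "\<And>x y m. x \<in> V \<Longrightarrow> y \<in> V \<Longrightarrow> d x = d y \<Longrightarrow> d x \<le> m \<Longrightarrow> a x m = a y m"
    using Alg_Lat_orbit[OF A] by blast
  have "?c (S f) = shift_op X (?c f)" if "f \<in> l2 V" for f
  proof -
    have "?c (L f) = shift X (?c f)"
      using sub rX parX by (auto simp: cutoff_def shift_def fun_eq_iff)
    then show ?thesis
      using that l2_cutoff_subset(1)[OF sub that] by (simp add: shift_op_def)
  qed
  then have comp: "compression X A \<in> wot_algebra X (shift_op X)"
    using compression_in_Alg_Lat[OF sub S_bounded bX _ A] refl by blast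
  have comm: "compression X A (shift_op X f) = shift_op X (compression X A f)" if "f \<in> l2 X" for f
    by (rule wot_algebra_commute[where \<alpha> = "\<lambda>v. if v \<in> X - {r} then of_real (lam v) else 0"
            and \<pi> = p, OF bX _ comp that])
      (use that in \<open>auto simp: shift_op_def shift_def\<close>)
  have childa: "a u (Suc m) = a x m"
    if x: "x \<in> X" and u: "u \<in> X" "u \<noteq> r" "p u = x" and m: "d x \<le> m" for x u m
  proof -
    have uV: "u \<in> V" and xV: "x \<in> V" and du: "d u = Suc (d x)"
      using u x sub depth_Suc by auto
    \<comment> \<open>Within the path, everything strictly below \<open>x\<close> descends from its
      only path child \<open>u\<close>, so the two orbits differ there by the weight of
      \<open>u\<close>.\<close>
    have orb: "orbit x w = of_real (lam u) * orbit u w" if "w \<in> X" "d u \<le> d w" for w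
      using that
    proof (induction "d w" arbitrary: w)
      case 0
      then show ?case
        using du by simp
    next
      case (Suc n)
      have wV: "w \<in> V" and wr: "w \<noteq> r"
        using Suc sub depth_root by auto
      have dw: "d w = Suc (d (p w))" "p w \<in> X"
        using depth_Suc[OF wV wr] parX Suc wr by auto
      show ?case
      proof (cases "d u < d w")
        case True
        then show ?thesis
          using Suc.hyps(1)[of "p w"] Suc.hyps(2) dw wV du by (simp add: orbit_step)
      next
        case False
        then have deq: "d w = d u" "d (p w) = d x"
          using Suc.prems du dw by auto
        have "p w = x \<longleftrightarrow> w = u"
          using childX[OF x] u Suc.prems wr by blast
        then show ?thesis
          using wV deq du by (simp add: orbit_step[of w x] orbit_shallow) (auto simp: delta_def)
      qed
    qed
    \<comment> \<open>The factors can be compared only at a path vertex where the orbit does not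
      vanish; walking down the path supplies one.\<close>
    have "\<exists>w\<in>X. w \<noteq> r \<and> d w = Suc m \<and> orbit x w \<noteq> 0"
      using m
    proof (induction m rule: dec_induct)
      case base
      have "orbit x u = of_real (lam u)"
        using orb[OF u(1)] by (simp add: orbit_shallow delta_def)
      then show ?case
        using u du lam_pos[OF uV u(2)] by (intro bexI[of _ u]) auto
    next
      case (step m)
      then obtain w where w: "w \<in> X" "d w = Suc m" "orbit x w \<noteq> 0"
        by blast
      obtain t where t: "t \<in> X" "t \<noteq> r" "p t = w"
        using childX w(1) by blast
      have tV: "t \<in> V"
        using t sub by blast
      have "d t = Suc (Suc m)"
        using depth_Suc[OF tV] t w by simp
      then show ?case
        using w t step lam_pos[OF tV t(2)] by (intro bexI[of _ t]) (auto simp: orbit_step[OF tV])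
    qed
    then obtain w where w: "w \<in> X" "w \<noteq> r" "d w = Suc m" "orbit x w \<noteq> 0"
      by blast
    have wV: "w \<in> V" and pw: "p w \<in> V" "p w \<in> X" "d (p w) = m"
      using w sub parX depth_Suc by auto
    have dx: "delta x \<in> l2 X" and dl: "delta u \<in> l2 X" "delta u \<in> l2 V"
      using x u uV by (auto intro: delta_l2)
    have AV: "A \<in> bounded_ops V"
      using A by (simp add: Alg_def)
    have "shift X (delta x) = (\<lambda>v. of_real (lam u) * delta u v)"
    proof
      fix v
      have "v \<in> X \<Longrightarrow> v \<noteq> r \<Longrightarrow> p v = x \<longleftrightarrow> v = u"
        using childX[OF x] u by blast
      then show "shift X (delta x) v = of_real (lam u) * delta u v"
        using u by (auto simp: shift_def delta_def)
    qed
    then have "compression X A (shift_op X (delta x)) w = of_real (lam u) * A (delta u) w"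
      using dx dl w bounded_ops_scale[OF AV dl(2)]
      by (simp add: shift_op_def compression_def l2_scale(1) cutoff_def)
    moreover have "shift_op X (compression X A (delta x)) w = of_real (lam w) * A (delta x) (p w)"
      using dx w pw bounded_ops_l2[OF compression_bounded[OF sub AV] dx]
      by (simp add: shift_op_def shift_def) (simp add: compression_def cutoff_def)
    ultimately have "of_real (lam u) * A (delta u) w = of_real (lam w) * A (delta x) (p w)"
      using comm[OF dx] by simp
    then have "a u (Suc m) * (of_real (lam u) * orbit u w) = a x m * (of_real (lam w) * orbit x (p w))"
      using a uV xV wV pw w by (simp add: mult_ac)
    then have "a u (Suc m) * orbit x w = a x m * orbit x w"
      using orb[OF w(1)] orbit_step[OF wV, of x] w m du by simp
    then show ?thesis
      using w by simp
  qed
  \<comment> \<open>The path meets every level, so each tree vertex can be exchanged for a path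
    vertex of its level.\<close>
  have levelX: "\<exists>x\<in>X. d x = n" for n
  proof (induction n)
    case 0
    then show ?case
      using rX depth_root by blast
  next
    case (Suc n)
    then obtain x where x: "x \<in> X" "d x = n" by blast
    then obtain u where "u \<in> X" "u \<noteq> r" "p u = x"
      using childX by blast
    then show ?case
      using x depth_Suc[of u] sub by auto
  qed
  \<comment> \<open>In the induction step, \<open>level\<close> replaces \<open>v\<close> by a path
    vertex \<open>u\<close> of its level, \<open>childa\<close> passes to the parent
    \<open>x\<close> of \<open>u\<close>, and the induction hypothesis applies to
    \<open>x\<close>.\<close>
  have shifta: "a v m = a r (m - d v)" if "v \<in> V" "d v \<le> m" for v m
    using that
  proof (induction "d v" arbitrary: v m)
    case 0
    then have "v = r"
      using depth_0_iff by simp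
    then show ?case
      using depth_root by simp
  next
    case (Suc n)
    obtain x where x: "x \<in> X" "d x = n"
      using levelX by blast
    obtain u where u: "u \<in> X" "u \<noteq> r" "p u = x"
      using childX[OF x(1)] by blast
    have du: "d u = d v"
      using depth_Suc[of u] sub u x Suc by auto
    obtain m' where m': "m = Suc m'" "n \<le> m'"
      using Suc by (cases m) auto
    have "a v m = a u m"
      using level[of v u m] Suc.prems u sub du by auto
    also have "\<dots> = a x m'"
      using childa[OF x(1) u] m' x by simp
    also have "\<dots> = a r (m' - n)"
      using Suc.hyps(1)[of x m'] x sub m' by auto
    finally show ?case
      using Suc.hyps(2) m' by (metis diff_Suc_Suc)
  qed
  define \<phi> where "\<phi> k = a r k" for k
  have Adelta: "A (delta x) w = (\<Sum>k\<le>d w. \<phi> k * (L ^^ k) (delta x) w)" if "x \<in> V" "w \<in> V" for x w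
  proof (cases "d x \<le> d w")
    case True
    have "(\<Sum>k\<le>d w. \<phi> k * (L ^^ k) (delta x) w) =
        (\<Sum>k\<le>d w. if k = d w - d x then \<phi> (d w - d x) * orbit x w else 0)"
      using True by (intro sum.cong) (auto simp: L_pow_delta that)
    also have "\<dots> = \<phi> (d w - d x) * orbit x w"
      by simp
    finally show ?thesis
      using a[OF that] shifta[OF that(1) True] by (simp add: \<phi>_def)
  next
    case False
    then have "orbit x w = 0"
      by (auto simp: orbit_shallow delta_def)
    then show ?thesis
      using False a[OF that] by (simp add: L_pow_delta that)
  qed
  have "A f w = (\<Sum>k\<le>d w. \<phi> k * (L ^^ k) f w)" if f: "f \<in> l2 V" and w: "w \<in> V" for f w
  proof -
    obtain F where F: "finite F" "F \<subseteq> V" "w \<in> F" "\<And>v. v \<in> F \<Longrightarrow> v \<noteq> r \<Longrightarrow> p v \<in> F"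
      using finite_ancestors[OF w] by blast
    have "A f w = (\<Sum>u\<in>F. f u * A (delta u) w)"
      by (rule Alg_Lat_ancestors[OF A w F f])
    also have "\<dots> = (\<Sum>u\<in>F. f u * (\<Sum>k\<le>d w. \<phi> k * (L ^^ k) (delta u) w))"
      using F(2) w Adelta by (intro sum.cong) auto
    also have "\<dots> = (\<Sum>k\<le>d w. \<phi> k * (\<Sum>u\<in>F. f u * (L ^^ k) (delta u) w))"
      unfolding sum_distrib_left by (subst sum.swap) (simp add: mult_ac)
    also have "\<dots> = (\<Sum>k\<le>d w. \<phi> k * (L ^^ k) f w)"
    proof (rule sum.cong)
      have "(L ^^ k) f w = (\<Sum>u\<in>F. f u * (L ^^ k) (delta u) w)" for k
        by (rule L_pow_ancestors) (use F in auto)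
      then show "\<phi> k * (\<Sum>u\<in>F. f u * (L ^^ k) (delta u) w) = \<phi> k * (L ^^ k) f w" for k
        by (simp only:)
    qed simp
    finally show ?thesis .
  qed
  then show ?thesis
    by blast
qed

section \<open>Bounded multipliers are weak limits of polynomials\<close>

lemma polynomial_in_wot_algebra:
  "restrict (\<lambda>f v. \<Sum>k<n. c k * (L ^^ k) f v) (l2 V) \<in> wot_algebra V S"
proof -
  have W: "unital_subalgebra V (wot_algebra V S)"
    by (rule unital_subalgebra_wot_algebra[OF S_bounded])
  have pow: "restrict (L ^^ k) (l2 V) \<in> wot_algebra V S" for k
  proof (induction k)
    case 0
    have "restrict (L ^^ 0) (l2 V) = op_id V"
      by (auto simp: op_id_def)
    then show ?case
      using W by (simp only: unital_subalgebra_def)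
  next
    case (Suc k)
    have "restrict (L ^^ Suc k) (l2 V) = compose (l2 V) S (restrict (L ^^ k) (l2 V))"
      unfolding compose_def by (rule restrict_ext) (simp add: S_apply L_pow_l2)
    then show ?case
      using W Suc self_in_wot_algebra[of S V] by (simp only: unital_subalgebra_def)
  qed
  show ?thesis
  proof (induction n)
    case 0
    have "restrict (\<lambda>f v. \<Sum>k<0. c k * (L ^^ k) f v) (l2 V) = op_scale V 0 (op_id V)"
      by (auto simp: op_scale_def)
    then show ?case
      using W by (simp add: unital_subalgebra_def)
  next
    case (Suc n)
    have "restrict (\<lambda>f v. \<Sum>k<Suc n. c k * (L ^^ k) f v) (l2 V) =
        op_add V (restrict (\<lambda>f v. \<Sum>k<n. c k * (L ^^ k) f v) (l2 V))
          (op_scale V (c n) (restrict (L ^^ n) (l2 V)))"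
      unfolding op_add_def op_scale_def by (rule restrict_ext) simp
    then show ?case
      using W Suc pow[of n] by (simp only: unital_subalgebra_def)
  qed
qed

text \<open>Additive form on purpose: with natural subtraction, \<open>m - n < d v\<close> would
  drop the root level for \<open>m < n\<close>.\<close>

definition window :: "nat \<Rightarrow> nat \<Rightarrow> ('a \<Rightarrow> complex) \<Rightarrow> 'a \<Rightarrow> complex" where
  "window n m = cutoff (\<lambda>v. d v \<le> m \<and> m < d v + n)"

lemma L_pow_window:
  assumes "w \<in> V" "k \<le> d w"
  shows "(L ^^ k) (window n m f) w = (if d w \<le> m + k \<and> m + k < d w + n then (L ^^ k) f w else 0)"
  using assms
proof (induction k arbitrary: w)
  case 0
  then show ?case
    by (simp add: window_def cutoff_def)
next
  case (Suc k)
  then show ?case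
    by (cases "w = r") (auto simp: depth_root parent_in depth_Suc)
qed

text \<open>A vertex \<open>v\<close> lies in the windows with \<open>d v \<le> m < d v + n\<close>
  only, hence in at most \<open>n\<close> of them.\<close>

lemma sum_window_norm_le:
  assumes f: "f \<in> l2 V"
  shows "(\<Sum>m<M. (l2_norm V (window n m f))\<^sup>2) \<le> real n * (l2_norm V f)\<^sup>2"
proof -
  have win: "window n m f \<in> l2 V" for m
    using l2_cutoff(1)[OF f] by (simp add: window_def)
  have hs: "((\<lambda>v. (cmod (g v))\<^sup>2) has_sum (l2_norm V g)\<^sup>2) V" if "g \<in> l2 V" for g
    using that by (simp add: l2_def l2_norm_def infsum_nonneg)
  show ?thesis
  proof (rule has_sum_mono)
    show "((\<lambda>v. \<Sum>m<M. (cmod (window n m f v))\<^sup>2) has_sum (\<Sum>m<M. (l2_norm V (window n m f))\<^sup>2)) V"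
      by (induction M) (auto intro!: has_sum_add hs win)
    show "((\<lambda>v. real n * (cmod (f v))\<^sup>2) has_sum real n * (l2_norm V f)\<^sup>2) V"
      by (intro has_sum_cmult_right hs f)
    fix v
    have "(\<Sum>m<M. (cmod (window n m f v))\<^sup>2) = (\<Sum>m\<in>{m. m < M \<and> d v \<le> m \<and> m < d v + n}. (cmod (f v))\<^sup>2)"
      by (rule sum.mono_neutral_cong_right) (auto simp: window_def cutoff_def)
    also have "\<dots> = real (card {m. m < M \<and> d v \<le> m \<and> m < d v + n}) * (cmod (f v))\<^sup>2"
      by simp
    also have "\<dots> \<le> real n * (cmod (f v))\<^sup>2"
    proof -
      have "card {m. m < M \<and> d v \<le> m \<and> m < d v + n} \<le> card {d v..<d v + n}"
        by (rule card_mono) auto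
      then show ?thesis
        by (intro mult_right_mono) auto
    qed
    finally show "(\<Sum>m<M. (cmod (window n m f v))\<^sup>2) \<le> real n * (cmod (f v))\<^sup>2" .
  qed
qed

text \<open>The Cesaro mean of order \<open>n\<close> is the average over \<open>m\<close> of the compressions of \<open>A\<close> to the levels
  in \<open>{m - n<..m}\<close>, so its norm is at most that of \<open>A\<close>: this replaces integration against
  the Fejer kernel.\<close>

definition cesaro :: "(nat \<Rightarrow> complex) \<Rightarrow> nat \<Rightarrow> 'a operator" where
  "cesaro \<phi> n = restrict (\<lambda>f v. \<Sum>k<n. (of_nat (n - k) / of_nat n * \<phi> k) * (L ^^ k) f v) (l2 V)"

text \<open>The range of \<open>m\<close> consists of the windows containing the level of
  \<open>w\<close>. For \<open>k \<le> d w\<close>, exactly \<open>n - k\<close> of them also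
  contain the level \<open>d w - k\<close> from which \<open>L ^^ k\<close> reads, which produces
  the Cesaro weight.\<close>

lemma cesaro_eq_average:
  assumes A: "\<And>f w. f \<in> l2 V \<Longrightarrow> w \<in> V \<Longrightarrow> A f w = (\<Sum>k\<le>d w. \<phi> k * (L ^^ k) f w)"
    and f: "f \<in> l2 V" and w: "w \<in> V"
  shows "cesaro \<phi> n f w = (\<Sum>m = d w..<d w + n. A (window n m f) w) / of_nat n"
proof -
  have win: "window n m f \<in> l2 V" for m
    using l2_cutoff(1)[OF f] by (simp add: window_def)
  have "(\<Sum>m = d w..<d w + n. A (window n m f) w) =
      (\<Sum>k\<le>d w. \<Sum>m = d w..<d w + n. \<phi> k * (L ^^ k) (window n m f) w)"
    using A[OF win w] by (simp add: sum.swap[of _ "{..d w}"])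
  also have "\<dots> = (\<Sum>k\<le>d w. of_nat (n - k) * (\<phi> k * (L ^^ k) f w))"
  proof (rule sum.cong[OF refl])
    fix k assume k: "k \<in> {..d w}"
    have "(\<Sum>m = d w..<d w + n. \<phi> k * (L ^^ k) (window n m f) w) =
        (\<Sum>m = d w..<d w + (n - k). \<phi> k * (L ^^ k) f w)"
      using k w by (intro sum.mono_neutral_cong_right) (auto simp: L_pow_window)
    then show "(\<Sum>m = d w..<d w + n. \<phi> k * (L ^^ k) (window n m f) w) =
        of_nat (n - k) * (\<phi> k * (L ^^ k) f w)"
      by simp
  qed
  \<comment> \<open>The index range may change because iterates with \<open>k > d w\<close> vanish
    at \<open>w\<close>, and the truncated \<open>n - k\<close> is 0 for
    \<open>k \<ge> n\<close>.\<close>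
  also have "\<dots> = (\<Sum>k<n. of_nat (n - k) * (\<phi> k * (L ^^ k) f w))"
    using w by (intro sum.mono_neutral_cong) (auto simp: L_pow_shallow)
  finally show ?thesis
    using f by (simp add: cesaro_def sum_divide_distrib mult_ac)
qed

text \<open>By Cauchy-Schwarz, the squared average over \<open>n\<close> windows is at most 1/n
  times the sum of the squares. Summing over vertices and applying the bound for \<open>A\<close>
  leaves the norms of the windows, whose overlap of at most \<open>n\<close> cancels the
  1/n.\<close>

lemma cesaro_bound:
  assumes A: "\<And>f w. f \<in> l2 V \<Longrightarrow> w \<in> V \<Longrightarrow> A f w = (\<Sum>k\<le>d w. \<phi> k * (L ^^ k) f w)"
    and AV: "A \<in> bounded_ops V"
    and K: "0 \<le> K" "\<And>f. f \<in> l2 V \<Longrightarrow> l2_norm V (A f) \<le> K * l2_norm V f"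
    and f: "f \<in> l2 V"
  shows "l2_norm V (cesaro \<phi> n f) \<le> K * l2_norm V f"
proof (rule l2_finite_boundI(2))
  have "cesaro \<phi> n \<in> wot_algebra V S"
    unfolding cesaro_def by (rule polynomial_in_wot_algebra)
  then have "cesaro \<phi> n f \<in> l2 V"
    using wot_algebra_subset_bounded_ops[OF S_bounded] bounded_ops_l2 f by blast
  then show "cesaro \<phi> n f v = 0" if "v \<notin> V" for v
    using that by (rule l2_eq_0)
  show "0 \<le> K * l2_norm V f"
    using K(1) by (simp add: l2_norm_nonneg)
  fix F assume F: "finite F" "F \<subseteq> V"
  have win: "window n m f \<in> l2 V" for m
    using l2_cutoff(1)[OF f] by (simp add: window_def)
  show "(\<Sum>v\<in>F. (cmod (cesaro \<phi> n f v))\<^sup>2) \<le> (K * l2_norm V f)\<^sup>2"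
  proof (cases "n = 0")
    case True
    then show ?thesis
      using f by (simp add: cesaro_def)
  next
    case False
    \<comment> \<open>Large enough for the averaging intervals of all \<open>v\<close> in
      \<open>F\<close> to lie in one range, so that the sums over \<open>m\<close> and
      \<open>v\<close> can be exchanged.\<close>
    define M where "M = (\<Sum>v\<in>F. d v) + n"
    let ?a = "\<lambda>m v. (cmod (A (window n m f) v))\<^sup>2"
    have "(cmod (cesaro \<phi> n f v))\<^sup>2 \<le> (\<Sum>m<M. ?a m v) / n" if v: "v \<in> F" for v
    proof -
      have vV: "v \<in> V"
        using v F by blast
      have "d v \<le> (\<Sum>v\<in>F. d v)"
        using v F(1) by (intro member_le_sum) auto
      then have M: "{d v..<d v + n} \<subseteq> {..<M}"
        by (auto simp: M_def)
      have "cmod (\<Sum>m = d v..<d v + n. A (window n m f) v) \<le>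
          (\<Sum>m = d v..<d v + n. cmod (A (window n m f) v))"
        by (rule norm_sum)
      then have "(cmod (\<Sum>m = d v..<d v + n. A (window n m f) v))\<^sup>2 \<le>
          (\<Sum>m = d v..<d v + n. cmod (A (window n m f) v))\<^sup>2"
        by (intro power_mono) auto
      also have "\<dots> \<le> n * (\<Sum>m = d v..<d v + n. ?a m v)"
        using sum_squared_le_sum_of_squares[of "\<lambda>m. cmod (A (window n m f) v)" "{d v..<d v + n}"]
        by (simp add: mult.commute)
      also have "\<dots> \<le> n * (\<Sum>m<M. ?a m v)"
        using M by (intro mult_left_mono sum_mono2) auto
      finally show ?thesis
        using False by (simp add: cesaro_eq_average[OF A f vV] norm_divide power_divide power2_eq_square divide_simps mult_ac)
    qed
    then have "(\<Sum>v\<in>F. (cmod (cesaro \<phi> n f v))\<^sup>2) \<le> (\<Sum>v\<in>F. (\<Sum>m<M. ?a m v) / n)"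
      by (rule sum_mono)
    also have "\<dots> = (\<Sum>m<M. \<Sum>v\<in>F. ?a m v) / n"
      by (simp add: sum_divide_distrib sum.swap[of _ F])
    also have "\<dots> \<le> (\<Sum>m<M. K\<^sup>2 * (l2_norm V (window n m f))\<^sup>2) / n"
    proof (intro divide_right_mono sum_mono)
      fix m
      have "(\<Sum>v\<in>F. ?a m v) \<le> (l2_norm V (A (window n m f)))\<^sup>2"
        by (rule l2_finite_sum_le[OF bounded_ops_l2[OF AV win] F(1)])
      also have "\<dots> \<le> (K * l2_norm V (window n m f))\<^sup>2"
        by (intro power_mono K(2) win l2_norm_nonneg)
      finally show "(\<Sum>v\<in>F. ?a m v) \<le> K\<^sup>2 * (l2_norm V (window n m f))\<^sup>2"
        by (simp add: power_mult_distrib)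
    qed simp
    also have "\<dots> \<le> K\<^sup>2 * (n * (l2_norm V f)\<^sup>2) / n"
      unfolding sum_distrib_left[symmetric]
      by (intro divide_right_mono mult_left_mono sum_window_norm_le f) auto
    also have "\<dots> = (K * l2_norm V f)\<^sup>2"
      using False by (simp add: power_mult_distrib)
    finally show ?thesis .
  qed
qed

text \<open>At a fixed vertex only finitely many coefficients matter, and each weight tends to
  1.\<close>

lemma cesaro_tendsto:
  assumes A: "\<And>f w. f \<in> l2 V \<Longrightarrow> w \<in> V \<Longrightarrow> A f w = (\<Sum>k\<le>d w. \<phi> k * (L ^^ k) f w)"
    and f: "f \<in> l2 V" and w: "w \<in> V"
  shows "(\<lambda>n. cesaro \<phi> n f w) \<longlonglongrightarrow> A f w"
proof -
  have "(\<lambda>n. real (n - k) / real n) \<longlonglongrightarrow> 1" for k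
  proof (rule Lim_transform_eventually)
    show "(\<lambda>n. 1 - real k / real n) \<longlonglongrightarrow> 1"
      using tendsto_diff[OF tendsto_const[of 1] lim_const_over_n[of "real k"]] by simp
    \<comment> \<open>From \<open>Suc k\<close> on, the subtraction is not truncated and
      \<open>n\<close> is nonzero.\<close>
    show "eventually (\<lambda>n. 1 - real k / real n = real (n - k) / real n) sequentially"
      using eventually_ge_at_top[of "Suc k"]
      by eventually_elim (simp add: of_nat_diff diff_divide_distrib)
  qed
  from tendsto_of_real[OF this, where 'a = complex]
  have c: "(\<lambda>n. of_nat (n - k) / of_nat n :: complex) \<longlonglongrightarrow> 1" for k
    by simp
  have "(\<lambda>n. \<Sum>k\<le>d w. (of_nat (n - k) / of_nat n * \<phi> k) * (L ^^ k) f w) \<longlonglongrightarrow>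
      (\<Sum>k\<le>d w. (1 * \<phi> k) * (L ^^ k) f w)"
    by (intro tendsto_intros c)
  moreover have "cesaro \<phi> n f w = (\<Sum>k\<le>d w. (of_nat (n - k) / of_nat n * \<phi> k) * (L ^^ k) f w)" for n
    using f w unfolding cesaro_def
    by (simp, intro sum.mono_neutral_cong) (auto simp: L_pow_shallow)
  ultimately show ?thesis
    using A[OF f w] by simp
qed

lemma multiplier_in_wot_algebra:
  assumes AV: "A \<in> bounded_ops V"
    and A: "\<And>f w. f \<in> l2 V \<Longrightarrow> w \<in> V \<Longrightarrow> A f w = (\<Sum>k\<le>d w. \<phi> k * (L ^^ k) f w)"
  shows "A \<in> wot_algebra V S"
proof -
  obtain K where K: "0 \<le> K" "\<And>f. f \<in> l2 V \<Longrightarrow> l2_norm V (A f) \<le> K * l2_norm V f"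
    using bounded_ops_bound[OF AV] by blast
  have mem: "cesaro \<phi> n \<in> wot_algebra V S" for n
    unfolding cesaro_def by (rule polynomial_in_wot_algebra)
  then have bnd: "cesaro \<phi> n \<in> bounded_ops V" for n
    using wot_algebra_subset_bounded_ops[OF S_bounded] by blast
  have "limitin (wot V) (cesaro \<phi>) A sequentially"
  proof (rule limitin_wot[OF AV bnd])
    fix f g assume f: "f \<in> l2 V" and g: "g \<in> l2 V"
    show "(\<lambda>n. l2_inner V (cesaro \<phi> n f) g) \<longlonglongrightarrow> l2_inner V (A f) g"
      by (rule l2_inner_tendsto[OF bounded_ops_l2[OF bnd f] cesaro_bound[OF A AV K f]
            bounded_ops_l2[OF AV f] cesaro_tendsto[OF A f] g])
  qed
  then show ?thesis
    by (rule limitin_closedin[OF _ closedin_wot_algebra[OF S_bounded]]) (simp_all add: mem)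
qed

lemma reflexive_if_path_reflexive:
  assumes "X \<subseteq> V" "r \<in> X" "\<And>v. v \<in> X \<Longrightarrow> v \<noteq> r \<Longrightarrow> p v \<in> X"
    and "\<And>v. v \<in> X \<Longrightarrow> \<exists>!w. w \<in> X \<and> w \<noteq> r \<and> p w = v"
    and "reflexive_op X (shift_op X)"
  shows "reflexive_op V S"
proof -
  have "A \<in> wot_algebra V S" if A: "A \<in> Alg V (Lat V (wot_algebra V S))" for A
  proof -
    obtain \<phi> where "\<forall>f\<in>l2 V. \<forall>w\<in>V. A f w = (\<Sum>k\<le>d w. \<phi> k * (L ^^ k) f w)"
      using Alg_Lat_multiplier[OF A assms(1-4)] assms(5) by (auto simp: reflexive_op_def)
    then show ?thesis
      using A by (intro multiplier_in_wot_algebra) (auto simp: Alg_def)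
  qed
  moreover have "wot_algebra V S \<subseteq> Alg V (Lat V (wot_algebra V S))"
    using wot_algebra_subset_bounded_ops[OF S_bounded] by (auto simp: Alg_def Lat_def)
  ultimately show ?thesis
    using S_bounded by (auto simp: reflexive_op_def)
qed

end

section \<open>Rooted directed trees\<close>

lemma rooted_directed_tree_facts:
  assumes T: "rooted_directed_tree T"
  shows is_root_tree_root: "is_root T (tree_root T)"
    and parcs_iff_par: "(u, v) \<in> parcs T \<longleftrightarrow> v \<in> pverts T \<and> v \<noteq> tree_root T \<and> par T v = u"
    and parcs_in: "(u, v) \<in> parcs T \<Longrightarrow> u \<in> pverts T"
    and root_reaches: "v \<in> pverts T \<Longrightarrow> (tree_root T, v) \<in> (parcs T)\<^sup>*"
proof -
  let ?r = "tree_root T"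
  have ex1: "\<exists>!r. is_root T r" and dT: "directed_tree T"
    using T by (auto simp: rooted_directed_tree_def)
  show r: "is_root T ?r"
    unfolding tree_root_def by (rule theI'[OF ex1])
  have wf: "pair_wf_digraph T" and tr: "tree (with_proj T)"
    using dT by (auto simp: directed_tree_def)
  have in_T: "u \<in> pverts T" "v \<in> pverts T" if "(u, v) \<in> parcs T" for u v
    using that wf by (auto simp: pair_wf_digraph_def)
  have uT: "\<exists>!u. (u, v) \<in> parcs T" if "v \<in> pverts T" "v \<noteq> ?r" for v
    using dT that r ex1 by (auto simp: directed_tree_def)
  show par: "(u, v) \<in> parcs T \<longleftrightarrow> v \<in> pverts T \<and> v \<noteq> ?r \<and> par T v = u" for u v
  proof
    assume uv: "(u, v) \<in> parcs T"
    then have v: "v \<in> pverts T" "v \<noteq> ?r"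
      using in_T r by (auto simp: is_root_def)
    then show "v \<in> pverts T \<and> v \<noteq> ?r \<and> par T v = u"
      using uT[OF v] uv unfolding par_def by (simp add: the1_equality)
  next
    assume v: "v \<in> pverts T \<and> v \<noteq> ?r \<and> par T v = u"
    then show "(u, v) \<in> parcs T"
      using theI'[OF uT] unfolding par_def by blast
  qed
  show "u \<in> pverts T" if "(u, v) \<in> parcs T"
    using in_T that by blast
  show "(?r, v) \<in> (parcs T)\<^sup>*" if v: "v \<in> pverts T"
  proof -
    have "?r \<in> pverts T"
      using r by (simp add: is_root_def)
    then have "(?r, v) \<in> rtrancl_on (pverts T) (parcs (mk_symmetric (with_proj T)))"
      using tr v
      by (simp add: tree_def Digraph_Component.connected_def strongly_connected_def reachable_def
          mk_symmetric_def)
    then have "(?r, v) \<in> (parcs (mk_symmetric (with_proj T)))\<^sup>*"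
      by (simp add: rtrancl_on_rtranclI)
    then show ?thesis
    proof (induction rule: rtrancl_induct)
      case (step y z)
      from step.hyps(2) consider "(y, z) \<in> parcs T" | "(z, y) \<in> parcs T"
        by (auto simp: mk_symmetric_def)
      then show ?case
      proof cases
        case 1
        with step.IH show ?thesis by (rule rtrancl_into_rtrancl)
      next
        \<comment> \<open>A step against an arc leads from \<open>y\<close> to its unique parent,
          which the directed chain to \<open>y\<close> has already visited.\<close>
        case 2
        then have "y \<noteq> ?r"
          by (simp add: par)
        with step.IH obtain w where w: "(?r, w) \<in> (parcs T)\<^sup>*" "(w, y) \<in> parcs T"
          by (metis rtrancl.cases)
        with 2 have "w = z"
          by (simp add: par)
        with w show ?thesis by simp
      qed
    qed simp
  qed
qed

text \<open>The depth is the least number of parent steps to the root, finite because a directed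
  chain from the root can be read backwards. For a non-root vertex zero steps fail, so the least
  number is a successor. Parents beyond the root are junk values, which the least number never
  reaches.\<close>

lemma ex_depth:
  assumes T: "rooted_directed_tree T"
  shows "\<exists>d. d (tree_root T) = (0 :: nat) \<and>
    (\<forall>v\<in>pverts T. v \<noteq> tree_root T \<longrightarrow> d v = Suc (d (par T v)))"
proof -
  let ?r = "tree_root T"
  define d where "d v = (LEAST n. (par T ^^ n) v = ?r)" for v
  have "\<exists>n. (par T ^^ n) v = ?r" if "(?r, v) \<in> (parcs T)\<^sup>*" for v
    using that
  proof (induction rule: rtrancl_induct)
    case base
    show ?case
      by (intro exI[of _ 0]) simp
  next
    case (step y z)
    then obtain n where "(par T ^^ n) y = ?r"
      by blast
    moreover have "par T z = y"
      using step.hyps(2) parcs_iff_par[OF T] by blast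
    ultimately show ?case
      by (intro exI[of _ "Suc n"]) (simp add: funpow_swap1)
  qed
  then have ex: "\<exists>n. (par T ^^ n) v = ?r" if "v \<in> pverts T" for v
    using root_reaches[OF T that] by blast
  have "d v = Suc (d (par T v))" if v: "v \<in> pverts T" "v \<noteq> ?r" for v
  proof -
    obtain n where "(par T ^^ n) v = ?r"
      using ex[OF v(1)] by blast
    then show ?thesis
      using Least_Suc[of "\<lambda>n. (par T ^^ n) v = ?r" n] v(2)
      by (simp add: d_def funpow_swap1)
  qed
  moreover have "d ?r = 0"
    by (simp add: d_def)
  ultimately show ?thesis
    by blast
qed

theorem theorem31:
  fixes T P :: "'v pair_pre_digraph" and lam :: "'v \<Rightarrow> real"
  assumes "rooted_directed_tree T" and "leafless T"
    and "countable (pverts T)" and "infinite (pverts T)"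
    and "\<forall>v \<in> pverts T - {tree_root T}. lam v > 0"
    and "tree_path P T"
    and "wshift_dom T lam = l2 (pverts T)" and "wshift T lam \<in> bounded_ops (pverts T)"
    and "wshift_dom P lam = l2 (pverts P)" and "wshift P lam \<in> bounded_ops (pverts P)"
    and "reflexive_op (pverts P) (wshift P lam)"
  shows "reflexive_op (pverts T) (wshift T lam)"
proof -
  note T = assms(1) and P = tree_root_path[OF assms(1,6)]
  note arcT = parcs_iff_par[OF T] and arcP = parcs_iff_par[OF P(1), unfolded P(2)]
  have sub: "pverts P \<subseteq> pverts T" "parcs P \<subseteq> parcs T"
    using assms(6) by (auto simp: tree_path_def subgraph_def)
  \<comment> \<open>Arcs of the path are arcs of the tree, where parents are unique, so both parent
    maps agree on non-root path vertices.\<close>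
  have par: "par P v = par T v" "par T v \<in> pverts P" if "v \<in> pverts P" "v \<noteq> tree_root T" for v
  proof -
    have "(par P v, v) \<in> parcs P"
      using that by (simp add: arcP)
    then show "par P v = par T v" "par T v \<in> pverts P"
      using sub parcs_in[OF P(1)] arcT by auto
  qed
  have child: "\<exists>!w. w \<in> pverts P \<and> w \<noteq> tree_root T \<and> par T w = v" if "v \<in> pverts P" for v
  proof -
    have "\<exists>!w. (v, w) \<in> parcs P"
      using assms(6) that by (simp add: tree_path_def)
    moreover have "(v, w) \<in> parcs P \<longleftrightarrow> w \<in> pverts P \<and> w \<noteq> tree_root T \<and> par T w = v" for w
      using par arcP by auto
    ultimately show ?thesis
      by simp
  qed
  obtain d :: "'v \<Rightarrow> nat" where d: "d (tree_root T) = 0"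
    "\<And>v. v \<in> pverts T \<Longrightarrow> v \<noteq> tree_root T \<Longrightarrow> d v = Suc (d (par T v))"
    using ex_depth[OF T] by blast
  interpret weighted_tree "pverts T" "tree_root T" "par T" d lam
  proof
    show "tree_root T \<in> pverts T"
      using is_root_tree_root[OF T] by (simp add: is_root_def)
    show "par T v \<in> pverts T" if "v \<in> pverts T" "v \<noteq> tree_root T" for v
      using that arcT parcs_in[OF T] by blast
    show "\<exists>w\<in>pverts T. w \<noteq> tree_root T \<and> par T w = v" if "v \<in> pverts T" for v
      using that assms(2) arcT by (auto simp: leafless_def)
  qed (use d assms(5) in auto)
  \<comment> \<open>Since the maximal domain is all of \<open>l2\<close>, \<open>wshift\<close>
    restricts to the same set as \<open>shift_op\<close>.\<close>
  have ST: "wshift T lam = shift_op (pverts T)"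
    unfolding wshift_def assms(7) shift_op_def by (rule restrict_ext) (simp add: shift_map_def shift_def)
  have SP: "wshift P lam = shift_op (pverts P)"
    unfolding wshift_def assms(9) shift_op_def
    by (rule restrict_ext) (auto simp: shift_map_def shift_def P(2) par)
  interpret bounded_weighted_tree "pverts T" "tree_root T" "par T" d lam
    by unfold_locales (use assms(8) ST in simp)
  have "tree_root T \<in> pverts P"
    using assms(6) by (simp add: tree_path_def)
  then show ?thesis
    unfolding ST using sub(1) par(2) child assms(11)[unfolded SP]
    by (intro reflexive_if_path_reflexive)
qed

end
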